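(* Let $\mathcal{F},\mathcal{G}\colon\mathbf{rng}\to\mathbf{Alg}_{\mathbb{Z}}$ be two extension invariant algebra functors, and assume that for some field $K$ the $K$-algebras $\mathcal{F}(K)$ and $\mathcal{G}(K)$ are finite-dimensional and isomorphic as $K$-algebras. Let $Q$ be the prime field of $K$, let $\bar{Q}$ be an algebraic closure of $Q$, and let $R$ be any commutative unital ring containing $\bar{Q}$ as a (unital) subring. Then $\mathcal{F}(R)\cong\mathcal{G}(R)$ as $R$-algebras.
   Context: $\mathbf{rng}$ is the category of associative, commutative rings with non-zero unit (identified with the category $\mathbf{alg}_{\mathbb{Z}}$ of associative commutative unital $\mathbb{Z}$-algebras). $\mathbf{Alg}_{\mathbb{Z}}$ is the category of all $\mathbb{Z}$-algebras, not necessarily associative, commutative or unital. An algebra functor here is a functor $\mathcal{F}\colon\mathbf{rng}\to\mathbf{Alg}_{\mathbb{Z}}$ such that $\mathcal{F}(R)$ is an $R$-algebra for every $R\in\mathbf{rng}$. It is extension invariant if for every $R\in\mathbf{rng}$ there is an $R$-algebra isomorphism $\tau_R\colon\mathcal{F}(R)\to\mathcal{F}(\mathbb{Z})\otimes_{\mathbb{Z}} R$ that is natural in $R$, i.e. for every ring homomorphism $\alpha\colon R\to R'$ in $\mathbf{rng}$ one has $(1_{\mathcal{F}(\mathbb{Z})}\otimes_{\mathbb{Z}}\alpha)\circ\tau_R=\tau_{R'}\circ\mathcal{F}(\alpha)$. *)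

theory Defs
  imports "HOL-Algebra.Algebra" "Jordan_Normal_Form.Missing_VectorSpace"
begin

text \<open>
  The category \<open>rng\<close> is rendered as the category of all commutative unital non-zero rings whose
  carrier is a subset of an arbitrary type \<open>'u\<close>, which plays the role of the universe. Morphisms
  are required to be extensional so that two of them are equal iff they agree on the carrier.
\<close>

definition rng_obj :: "'u ring set" where
  "rng_obj = {R. cring R \<and> \<one>\<^bsub>R\<^esub> \<noteq> \<zero>\<^bsub>R\<^esub>}"

definition rng_hom :: "'u ring \<Rightarrow> 'u ring \<Rightarrow> ('u \<Rightarrow> 'u) set" where
  "rng_hom R S = ring_hom R S \<inter> extensional (carrier R)"


text \<open>
  An algebra over \<open>R\<close>, not necessarily associative, commutative or unital, is stored in a
  \<^typ>\<open>('a, 'b) module\<close> record; its \<^const>\<open>one\<close> field is never constrained and carries no meaning.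
\<close>

locale nonassoc_algebra = Module.module R A for R (structure) and A (structure) +
  assumes mult_closed:
      "\<lbrakk>x \<in> carrier A; y \<in> carrier A\<rbrakk> \<Longrightarrow> x \<otimes>\<^bsub>A\<^esub> y \<in> carrier A"
    and mult_l_distr:
      "\<lbrakk>x \<in> carrier A; y \<in> carrier A; z \<in> carrier A\<rbrakk>
        \<Longrightarrow> (x \<oplus>\<^bsub>A\<^esub> y) \<otimes>\<^bsub>A\<^esub> z = x \<otimes>\<^bsub>A\<^esub> z \<oplus>\<^bsub>A\<^esub> y \<otimes>\<^bsub>A\<^esub> z"
    and mult_r_distr:
      "\<lbrakk>x \<in> carrier A; y \<in> carrier A; z \<in> carrier A\<rbrakk>
        \<Longrightarrow> z \<otimes>\<^bsub>A\<^esub> (x \<oplus>\<^bsub>A\<^esub> y) = z \<otimes>\<^bsub>A\<^esub> x \<oplus>\<^bsub>A\<^esub> z \<otimes>\<^bsub>A\<^esub> y"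
    and mult_smult_l:
      "\<lbrakk>r \<in> carrier R; x \<in> carrier A; y \<in> carrier A\<rbrakk>
        \<Longrightarrow> (r \<odot>\<^bsub>A\<^esub> x) \<otimes>\<^bsub>A\<^esub> y = r \<odot>\<^bsub>A\<^esub> (x \<otimes>\<^bsub>A\<^esub> y)"
    and mult_smult_r:
      "\<lbrakk>r \<in> carrier R; x \<in> carrier A; y \<in> carrier A\<rbrakk>
        \<Longrightarrow> x \<otimes>\<^bsub>A\<^esub> (r \<odot>\<^bsub>A\<^esub> y) = r \<odot>\<^bsub>A\<^esub> (x \<otimes>\<^bsub>A\<^esub> y)"

definition alg_iso :: "'u ring \<Rightarrow> ('u, 'b) module \<Rightarrow> ('u, 'c) module \<Rightarrow> ('b \<Rightarrow> 'c) set" where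
  "alg_iso R A B =
     {h. h \<in> module_hom R A B \<and> h \<in> hom A B \<and> bij_betw h (carrier A) (carrier B)}"

definition alg_isomorphic :: "'u ring \<Rightarrow> ('u, 'b) module \<Rightarrow> ('u, 'c) module \<Rightarrow> bool" where
  "alg_isomorphic R A B \<longleftrightarrow> alg_iso R A B \<noteq> {}"

text \<open>
  Morphisms of \<open>\<int>\<close>-algebras: additivity already implies \<open>\<int>\<close>-linearity. The underlying
  \<open>\<int>\<close>-algebra of an \<open>R\<close>-algebra is given by its addition and multiplication.
\<close>

definition Zalg_hom :: "('u, 'b) module \<Rightarrow> ('u, 'c) module \<Rightarrow> ('b \<Rightarrow> 'c) set" where
  "Zalg_hom A B = hom (add_monoid A) (add_monoid B) \<inter> hom A B"


record ('u, 'b) functor_data =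
  Ob :: "'u ring \<Rightarrow> ('u, 'b) module"
  Mor :: "'u ring \<Rightarrow> 'u ring \<Rightarrow> ('u \<Rightarrow> 'u) \<Rightarrow> 'b \<Rightarrow> 'b"

locale algebra_functor =
  fixes F :: "('u, 'b) functor_data"
  assumes Ob_algebra:
      "R \<in> rng_obj \<Longrightarrow> nonassoc_algebra R (Ob F R)"
    and Mor_hom:
      "\<lbrakk>R \<in> rng_obj; S \<in> rng_obj; \<alpha> \<in> rng_hom R S\<rbrakk>
        \<Longrightarrow> Mor F R S \<alpha> \<in> Zalg_hom (Ob F R) (Ob F S)"
    and Mor_id:
      "\<lbrakk>R \<in> rng_obj; x \<in> carrier (Ob F R)\<rbrakk>
        \<Longrightarrow> Mor F R R (\<lambda>r\<in>carrier R. r) x = x"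
    and Mor_comp:
      "\<lbrakk>R \<in> rng_obj; S \<in> rng_obj; T \<in> rng_obj; \<alpha> \<in> rng_hom R S; \<beta> \<in> rng_hom S T;
        x \<in> carrier (Ob F R)\<rbrakk>
        \<Longrightarrow> Mor F R T (compose (carrier R) \<beta> \<alpha>) x = Mor F S T \<beta> (Mor F R S \<alpha> x)"


text \<open>
  The tensor product over \<open>\<int>\<close> of a \<open>\<int>\<close>-algebra \<open>A\<close> and a ring \<open>R\<close>, as the quotient of the free
  abelian group on \<open>A \<times> R\<close> by the biadditivity relations (balancedness over \<open>\<int>\<close> follows from
  these), with the \<open>R\<close>-algebra structure determined by
  \<open>(a \<otimes> r) (a' \<otimes> r') = a a' \<otimes> r r'\<close> and \<open>s (a \<otimes> r) = a \<otimes> s r\<close>.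
  Operations on cosets are induced from operations on representatives.
\<close>

abbreviation tensor_free ::
  "('v, 'b) module \<Rightarrow> 'u ring \<Rightarrow> ('b \<times> 'u \<Rightarrow>\<^sub>0 int) monoid" where
  "tensor_free A R \<equiv> free_Abelian_group (carrier A \<times> carrier R)"

definition tensor_relators ::
  "('v, 'b) module \<Rightarrow> 'u ring \<Rightarrow> ('b \<times> 'u \<Rightarrow>\<^sub>0 int) set" where
  "tensor_relators A R =
     {frag_of (a \<oplus>\<^bsub>A\<^esub> a', r) - frag_of (a, r) - frag_of (a', r) |a a' r.
        a \<in> carrier A \<and> a' \<in> carrier A \<and> r \<in> carrier R} \<union>
     {frag_of (a, r \<oplus>\<^bsub>R\<^esub> r') - frag_of (a, r) - frag_of (a, r') |a r r'.
        a \<in> carrier A \<and> r \<in> carrier R \<and> r' \<in> carrier R}"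

definition tensor_ker ::
  "('v, 'b) module \<Rightarrow> 'u ring \<Rightarrow> ('b \<times> 'u \<Rightarrow>\<^sub>0 int) set" where
  "tensor_ker A R = generate (tensor_free A R) (tensor_relators A R)"

definition tensor_coset ::
  "('v, 'b) module \<Rightarrow> 'u ring \<Rightarrow> ('b \<times> 'u \<Rightarrow>\<^sub>0 int) \<Rightarrow> ('b \<times> 'u \<Rightarrow>\<^sub>0 int) set" where
  "tensor_coset A R x = tensor_ker A R #>\<^bsub>tensor_free A R\<^esub> x"

definition tensor_rep_mult ::
  "('v, 'b) module \<Rightarrow> 'u ring
    \<Rightarrow> ('b \<times> 'u \<Rightarrow>\<^sub>0 int) \<Rightarrow> ('b \<times> 'u \<Rightarrow>\<^sub>0 int) \<Rightarrow> ('b \<times> 'u \<Rightarrow>\<^sub>0 int)" where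
  "tensor_rep_mult A R x y =
     frag_extend (\<lambda>(a, r). frag_extend (\<lambda>(a', r'). frag_of (a \<otimes>\<^bsub>A\<^esub> a', r \<otimes>\<^bsub>R\<^esub> r')) y) x"

definition tensor_algebra ::
  "('v, 'b) module \<Rightarrow> 'u ring \<Rightarrow> ('u, ('b \<times> 'u \<Rightarrow>\<^sub>0 int) set) module" where
  "tensor_algebra A R =
     \<lparr>carrier = carrier (tensor_free A R Mod tensor_ker A R),
      monoid.mult = (\<lambda>U V. \<Union>x\<in>U. \<Union>y\<in>V. tensor_coset A R (tensor_rep_mult A R x y)),
      one = undefined,
      ring.zero = \<one>\<^bsub>tensor_free A R Mod tensor_ker A R\<^esub>,
      ring.add = monoid.mult (tensor_free A R Mod tensor_ker A R),
      module.smult = (\<lambda>s U. \<Union>x\<in>U. tensor_coset A R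
                 (frag_extend (\<lambda>(a, r). frag_of (a, s \<otimes>\<^bsub>R\<^esub> r)) x))\<rparr>"

text \<open>The map \<open>1 \<otimes> \<alpha>\<close> from \<open>A \<otimes> R\<close> to \<open>A \<otimes> S\<close>; the source ring is not needed.\<close>

definition tensor_map ::
  "('v, 'b) module \<Rightarrow> 'u ring \<Rightarrow> ('u \<Rightarrow> 'u)
    \<Rightarrow> ('b \<times> 'u \<Rightarrow>\<^sub>0 int) set \<Rightarrow> ('b \<times> 'u \<Rightarrow>\<^sub>0 int) set" where
  "tensor_map A S \<alpha> U =
     (\<Union>x\<in>U. tensor_coset A S (frag_extend (\<lambda>(a, r). frag_of (a, \<alpha> r)) x))"


text \<open>
  The integers have to be an object of the universe, whence the parameter \<open>Z\<close>: an isomorphic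
  copy, with carrier in \<open>'u\<close>, of the ring of integers.
\<close>

definition integers_object :: "'u ring \<Rightarrow> bool" where
  "integers_object Z \<longleftrightarrow> Z \<in> rng_obj \<and> Z \<simeq> int_ring"

locale extension_invariant = algebra_functor F
  for Z :: "'u ring" and F :: "('u, 'b) functor_data" +
  assumes invariant:
    "\<exists>\<tau>. (\<forall>R\<in>rng_obj. \<tau> R \<in> alg_iso R (Ob F R) (tensor_algebra (Ob F Z) R)) \<and>
         (\<forall>R\<in>rng_obj. \<forall>S\<in>rng_obj. \<forall>\<alpha>\<in>rng_hom R S. \<forall>x\<in>carrier (Ob F R).
            tensor_map (Ob F Z) S \<alpha> (\<tau> R x) = \<tau> S (Mor F R S \<alpha> x))"


definition prime_field :: "'u ring \<Rightarrow> 'u set" where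
  "prime_field K = \<Inter>{L. subfield L K}"

text \<open>\<open>C\<close> is an algebraic closure of the field \<open>Q\<close> via the embedding \<open>i\<close>.\<close>

definition is_algebraic_closure :: "'q ring \<Rightarrow> 'u ring \<Rightarrow> ('u \<Rightarrow> 'q) \<Rightarrow> bool" where
  "is_algebraic_closure C Q i \<longleftrightarrow> i \<in> ring_hom Q C \<and> algebraic_closure C (i ` carrier Q)"

end

theory Submission
  imports Defs
begin

text \<open>
  Write \<open>Q\<close> for the prime field of \<open>K\<close>. In suitable bases an isomorphism
  \<open>F(K) \<rightarrow> G(K)\<close> is a finite matrix, and "being an isomorphism of algebras" is a finite system
  of polynomial equations over \<open>Q\<close> for the entries of this matrix and of its inverse. By the
  Nullstellensatz a system that is solvable in \<open>K\<close> is solvable in the algebraic closure of \<open>Q\<close>,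
  hence in every ring that contains this closure.

  No equation has to be written down. Let \<open>A\<close> be a subring of \<open>K\<close> that contains \<open>Q\<close> and the finitely
  many matrix entries. The Nullstellensatz takes the form that some such \<open>A\<close> has a ring homomorphism
  to the algebraic closure (\<open>partial_hom_to_algebraically_closed\<close>), which yields a homomorphism \<open>\<eta>: A \<rightarrow> R\<close>. Since \<open>F(A)\<close> is free and embeds into \<open>F(K)\<close>, the given isomorphism
  restricts to \<open>F(A) \<rightarrow> G(A)\<close>, and base change along \<open>\<eta>\<close> turns the restriction into
  \<open>F(R) \<rightarrow> G(R)\<close> (\<open>hom_specialises\<close>, \<open>alg_iso_specialises\<close>).

  What makes this work is that a finite basis of \<open>F(Q)\<close> is carried to a basis of \<open>F(S)\<close> by every
  homomorphism \<open>Q \<rightarrow> S\<close> (\<open>coordinates_base_change\<close>). Extension invariance provides this through two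
  facts about the underlying modules: \<open>F(S)\<close> is additively generated by elements that correspond to pure tensors
  (\<open>gen_induct\<close>), and biadditive maps on \<open>F(\<int>) \<times> S\<close> induce additive maps on \<open>F(S)\<close>
  (\<open>gen_universal\<close>). The products are compatible because the maps \<open>F(\<alpha>)\<close> are multiplicative. Finally
  \<open>F(Q)\<close> has a finite basis since \<open>F(K)\<close> has one: an additive retraction \<open>K \<rightarrow> Q\<close> induces an
  additive surjection of \<open>F(K)\<close> onto \<open>F(Q)\<close> that maps each line of \<open>F(K)\<close> into a finite-dimensional
  subspace (\<open>fin_dim_subfield\<close>).
\<close>

section \<open>Partial homomorphisms into algebraically closed fields\<close>

text \<open>
  Homomorphisms on a ring extension \<open>A[x]\<close> are obtained from evaluations of polynomials over \<open>A\<close>: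
  \<open>A[x]\<close> is the image of the evaluation \<open>f\<close> at \<open>x\<close>, and another evaluation \<open>g\<close> descends to this
  image as soon as it kills the relations of \<open>x\<close>.
\<close>

lemma ring_hom_factor:
  assumes P: "ring P" and K: "ring K" and C: "ring C"
    and f: "f \<in> ring_hom P K" and g: "g \<in> ring_hom P C"
    and ker: "\<And>p. \<lbrakk>p \<in> carrier P; f p = \<zero>\<^bsub>K\<^esub>\<rbrakk> \<Longrightarrow> g p = \<zero>\<^bsub>C\<^esub>"
  obtains h where "h \<in> ring_hom (K\<lparr>carrier := f ` carrier P\<rparr>) C"
    and "\<And>p. p \<in> carrier P \<Longrightarrow> h (f p) = g p"
proof -
  interpret P: ring P by fact
  interpret f: ring_hom_ring P K f
    using P K f by (simp add: ring_hom_ringI2)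
  interpret g: ring_hom_ring P C g
    using P C g by (simp add: ring_hom_ringI2)
  define h where "h y = g (SOME p. p \<in> carrier P \<and> f p = y)" for y
  have h: "h (f p) = g p" if p: "p \<in> carrier P" for p
  proof -
    define q where "q = (SOME q. q \<in> carrier P \<and> f q = f p)"
    have q: "q \<in> carrier P" "f q = f p"
      using someI[of "\<lambda>q. q \<in> carrier P \<and> f q = f p" p] p unfolding q_def by auto
    have "f (q \<ominus>\<^bsub>P\<^esub> p) = \<zero>\<^bsub>K\<^esub>"
      using p q by (simp add: a_minus_def f.S.r_neg)
    then have "g (q \<ominus>\<^bsub>P\<^esub> p) = \<zero>\<^bsub>C\<^esub>"
      using ker p q by simp
    then have "g q \<ominus>\<^bsub>C\<^esub> g p = \<zero>\<^bsub>C\<^esub>"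
      using p q by (simp add: a_minus_def)
    then have "g q = g p"
      using p q by (simp add: g.S.r_right_minus_eq)
    then show ?thesis by (simp add: h_def q_def)
  qed
  have "h \<in> ring_hom (K\<lparr>carrier := f ` carrier P\<rparr>) C"
    by (rule ring_hom_memI)
      (use h[OF P.one_closed] in \<open>auto simp: h simp flip: f.hom_mult f.hom_add\<close>)
  with h that show thesis by blast
qed

text \<open>
  This translates between the two representations of polynomials, by lists of coefficients and by
  coefficient functions: roots are provided for the former, the universal property for the latter.
\<close>

lemma eval_as_finsum:
  assumes "cring C" and "\<And>i. i \<le> d \<Longrightarrow> a i \<in> carrier C" and "\<xi> \<in> carrier C"
  shows "ring.eval C (map a (rev [0..<Suc d])) \<xi> = (\<Oplus>\<^bsub>C\<^esub>i\<in>{..d}. a i \<otimes>\<^bsub>C\<^esub> \<xi> [^]\<^bsub>C\<^esub> i)"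
proof -
  interpret cring C by fact
  show ?thesis
    using assms(2)
  proof (induction d)
    case (Suc d)
    then show ?case
      using assms(3) by (simp add: ring.eval.simps Pi_def)
  qed (use assms(3) in \<open>simp add: ring.eval.simps\<close>)
qed

text \<open>
  The polynomial obtained from \<open>f\<close> by applying \<open>\<phi>\<close> to the coefficients keeps its degree, because its
  leading coefficient does not vanish, and therefore has a root.
\<close>

lemma algebraically_closed_root:
  assumes C: "algebraically_closed C" and A: "cring A" and \<phi>: "\<phi> \<in> ring_hom A C"
    and f: "f \<in> carrier (UP A)" and d: "deg A f \<noteq> 0"
    and lc: "\<phi> (UnivPoly.coeff (UP A) f (deg A f)) \<noteq> \<zero>\<^bsub>C\<^esub>"
  obtains \<xi> where "\<xi> \<in> carrier C" and "UnivPoly.eval A C \<phi> \<xi> f = \<zero>\<^bsub>C\<^esub>"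
proof -
  interpret C: algebraically_closed C by fact
  interpret UP_cring A "UP A" using A by (simp add: UP_cring_def)
  define a where "a i = \<phi> (UnivPoly.coeff (UP A) f i)" for i
  define p where "p = map a (rev [0..<Suc (deg A f)])"
  have a: "a i \<in> carrier C" for i
    using f \<phi> by (auto simp: a_def ring_hom_def)
  have p: "p \<in> carrier (poly_ring C)"
    using a lc by (auto simp: p_def univ_poly_carrier[symmetric] polynomial_def a_def[symmetric])
  have "size (C.roots p) = deg A f"
    using C.roots_over_carrier[OF p] by (simp add: C.splitted_def p_def)
  with d obtain \<xi> where "\<xi> \<in># C.roots p"
    by (metis multiset_nonemptyE size_eq_0_iff_empty)
  then have \<xi>: "\<xi> \<in> carrier C" "C.eval p \<xi> = \<zero>\<^bsub>C\<^esub>"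
    using C.roots_mem_iff_is_root[OF p] by (auto simp: C.is_root_def)
  have "UnivPoly.eval A C \<phi> \<xi> f = \<zero>\<^bsub>C\<^esub>"
    using \<xi>(2) eval_as_finsum[OF C.is_cring, of "deg A f" a \<xi>] a \<xi>(1)
    by (simp add: eval_on_carrier[OF f] p_def a_def)
  with \<xi>(1) that show thesis by blast
qed

lemma (in domain) nat_pow_nonzero:
  fixes k :: nat
  assumes "a \<in> carrier R" "a \<noteq> \<zero>"
  shows "a [^] k \<noteq> \<zero>"
  using assms by (induction k) (auto simp: integral_iff)

lemma (in UP_pre_univ_prop) eval_smult:
  assumes "s \<in> carrier S" "a \<in> carrier R" "p \<in> carrier P"
  shows "UnivPoly.eval R S h s (a \<odot>\<^bsub>P\<^esub> p) = h a \<otimes>\<^bsub>S\<^esub> UnivPoly.eval R S h s p"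
  using assms eval_ring_hom[OF assms(1)]
  by (simp add: monom_mult_is_smult[symmetric] ring_hom_mult eval_const)

text \<open>
  If \<open>s\<close> is algebraic over \<open>R\<close>, then so is every nonzero element of \<open>R[s]\<close>, and such an element
  divides a nonzero constant. The induction is the Euclidean algorithm with pseudo-division, run on
  \<open>p\<close> and a relation \<open>f\<close> of minimal degree; minimality excludes a common factor that vanishes at \<open>s\<close>.
\<close>

lemma (in UP_univ_prop) nonzero_multiple_in_base:
  assumes R: "domain R" and S: "domain S" and inj: "inj_on h (carrier R)"
    and f: "f \<in> carrier P" "f \<noteq> \<zero>\<^bsub>P\<^esub>" "Eval f = \<zero>\<^bsub>S\<^esub>"
    and min: "\<And>g. \<lbrakk>g \<in> carrier P; Eval g = \<zero>\<^bsub>S\<^esub>; deg R g < deg R f\<rbrakk> \<Longrightarrow> g = \<zero>\<^bsub>P\<^esub>"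
    and p: "p \<in> carrier P" "Eval p \<noteq> \<zero>\<^bsub>S\<^esub>"
  shows "\<exists>v\<in>carrier P. \<exists>c\<in>carrier R. c \<noteq> \<zero> \<and> Eval p \<otimes>\<^bsub>S\<^esub> Eval v = h c"
  using p
proof (induction "deg R p" arbitrary: p rule: less_induct)
  case less
  interpret R: domain R by fact
  interpret S: domain S by fact
  interpret D: UP_domain R P
    by unfold_locales
  have smult: "Eval (a \<odot>\<^bsub>P\<^esub> q) = h a \<otimes>\<^bsub>S\<^esub> Eval q" if "a \<in> carrier R" "q \<in> carrier P" for a q
    using eval_smult[OF indet_img_carrier that] by (simp add: Eval_def)
  have h0: "h a \<noteq> \<zero>\<^bsub>S\<^esub>" if "a \<in> carrier R" "a \<noteq> \<zero>" for a
  proof -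
    have "h \<in> ring_hom R S"
      using UP_pre_univ_prop.axioms(1)[OF UP_pre_univ_prop_axioms] by (rule ring_hom_cring.homh)
    then have "h \<zero> = \<zero>\<^bsub>S\<^esub>"
      using ring_hom_zero R.ring_axioms S.ring_axioms by blast
    then show ?thesis
      using inj that inj_onD[of h "carrier R" a \<zero>] by auto
  qed
  have p0: "p \<noteq> \<zero>\<^bsub>P\<^esub>"
    using less.prems ring_hom_zero[OF eval_ring_hom[OF indet_img_carrier] P.ring_axioms S.ring_axioms]
    by (auto simp: Eval_def)
  show ?case
  proof (cases "deg R p = 0")
    case True
    let ?c = "UnivPoly.coeff P p 0"
    have "p = UnivPoly.monom P ?c 0"
      using deg_zero_impl_monom[OF less.prems(1) True] by simp
    then have "Eval p = h ?c"
      using eval_const[OF indet_img_carrier, of ?c] less.prems by (simp add: Eval_def)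
    moreover from this less.prems have "?c \<noteq> \<zero>"
      by auto
    moreover have "Eval p \<otimes>\<^bsub>S\<^esub> Eval \<one>\<^bsub>P\<^esub> = Eval p"
      using less.prems(1) eval_ring_hom[OF indet_img_carrier]
      by (simp add: Eval_def ring_hom_one ring_hom_closed)
    ultimately show ?thesis
      using less.prems by (metis P.one_closed coeff_closed)
  next
    case pos: False
    show ?thesis
    proof (cases "deg R f \<le> deg R p")
      case True
      \<comment> \<open>Reduce \<open>p\<close> modulo the relation \<open>f\<close>; its value changes only by a nonzero constant factor.\<close>
      obtain g r and k :: nat where g: "g \<in> carrier P" and r: "r \<in> carrier P"
        and div: "(UnivPoly.coeff P f (deg R f)) [^] k \<odot>\<^bsub>P\<^esub> p = f \<otimes>\<^bsub>P\<^esub> g \<oplus>\<^bsub>P\<^esub> r"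
        and deg: "r = \<zero>\<^bsub>P\<^esub> \<or> deg R r < deg R f"
        using long_div_theorem[OF f(1) less.prems(1) f(2)] by blast
      let ?a = "(UnivPoly.coeff P f (deg R f)) [^] k"
      have a: "?a \<in> carrier R" "?a \<noteq> \<zero>"
        using f lcoeff_nonzero[OF f(2,1)] by (auto simp: R.nat_pow_nonzero)
      have Er: "h ?a \<otimes>\<^bsub>S\<^esub> Eval p = Eval r"
        using arg_cong[OF div, of Eval] a less.prems f g r by (simp add: smult)
      then have "Eval r \<noteq> \<zero>\<^bsub>S\<^esub>"
        using h0[OF a] a less.prems S.integral[of "h ?a" "Eval p"]
          ring_hom_closed[OF eval_ring_hom[OF indet_img_carrier]] by (auto simp: Eval_def)
      moreover from this deg have "deg R r < deg R f"
        by auto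
      ultimately obtain v c where v: "v \<in> carrier P" and c: "c \<in> carrier R" "c \<noteq> \<zero>"
        and eq: "Eval r \<otimes>\<^bsub>S\<^esub> Eval v = h c"
        using less.hyps[OF _ r] True by auto
      have "Eval p \<otimes>\<^bsub>S\<^esub> Eval (?a \<odot>\<^bsub>P\<^esub> v) = (h ?a \<otimes>\<^bsub>S\<^esub> Eval p) \<otimes>\<^bsub>S\<^esub> Eval v"
        using a v less.prems by (simp add: smult S.m_ac)
      then have "Eval p \<otimes>\<^bsub>S\<^esub> Eval (?a \<odot>\<^bsub>P\<^esub> v) = h c"
        using eq Er by simp
      with v c a show ?thesis by (meson smult_closed)
    next
      case False
      \<comment> \<open>Divide the relation \<open>f\<close> by \<open>p\<close>; the remainder has the value \<open>- p(s) g(s)\<close>.\<close>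
      obtain g r and k :: nat where g: "g \<in> carrier P" and r: "r \<in> carrier P"
        and div: "(UnivPoly.coeff P p (deg R p)) [^] k \<odot>\<^bsub>P\<^esub> f = p \<otimes>\<^bsub>P\<^esub> g \<oplus>\<^bsub>P\<^esub> r"
        and deg: "r = \<zero>\<^bsub>P\<^esub> \<or> deg R r < deg R p"
        using long_div_theorem[OF less.prems(1) f(1) p0] by blast
      let ?a = "(UnivPoly.coeff P p (deg R p)) [^] k"
      have a: "?a \<in> carrier R" "?a \<noteq> \<zero>"
        using less.prems lcoeff_nonzero[OF p0 less.prems(1)] by (auto simp: R.nat_pow_nonzero)
      have Er: "Eval p \<otimes>\<^bsub>S\<^esub> Eval g \<oplus>\<^bsub>S\<^esub> Eval r = \<zero>\<^bsub>S\<^esub>"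
        using arg_cong[OF div, of Eval] a less.prems f g r by (simp add: smult)
      show ?thesis
      proof (cases "Eval r = \<zero>\<^bsub>S\<^esub>")
        case True
        \<comment> \<open>This case is impossible: the quotient \<open>g\<close> would be a nonzero relation of smaller degree than \<open>f\<close>.\<close>
        have "r = \<zero>\<^bsub>P\<^esub>"
          using min[OF r True] deg False by linarith
        then have pg: "p \<otimes>\<^bsub>P\<^esub> g = ?a \<odot>\<^bsub>P\<^esub> f"
          using div less.prems g by simp
        have "Eval g = \<zero>\<^bsub>S\<^esub>"
          using Er True less.prems g by (simp add: S.integral_iff)
        moreover have "g \<noteq> \<zero>\<^bsub>P\<^esub>"
        proof
          assume "g = \<zero>\<^bsub>P\<^esub>"
          with pg less.prems have "UnivPoly.monom P ?a 0 \<otimes>\<^bsub>P\<^esub> f = \<zero>\<^bsub>P\<^esub>"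
            using a f by (simp add: monom_mult_is_smult)
          then have "UnivPoly.monom P ?a 0 = \<zero>\<^bsub>P\<^esub>"
            using a f D.UP_integral by (metis monom_closed)
          with a show False
            by (metis coeff_monom coeff_zero)
        qed
        moreover from this have "deg R p + deg R g = deg R f"
          using arg_cong[OF pg, of "deg R"] D.deg_smult[OF a(1) f(1)] a(2) less.prems(1) g p0
          by (simp add: D.deg_mult)
        ultimately show ?thesis
          using min[OF g] pos by linarith
      next
        case nz: False
        with deg have "deg R r < deg R p" by auto
        then obtain v c where v: "v \<in> carrier P" and c: "c \<in> carrier R" "c \<noteq> \<zero>"
          and eq: "Eval r \<otimes>\<^bsub>S\<^esub> Eval v = h c"
          using less.hyps[OF _ r nz] by auto
        have "Eval r = \<ominus>\<^bsub>S\<^esub> (Eval p \<otimes>\<^bsub>S\<^esub> Eval g)"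
          using Er less.prems g r by (simp add: S.minus_equality S.a_comm[of _ "Eval r"])
        moreover have "Eval p \<otimes>\<^bsub>S\<^esub> Eval ((\<ominus>\<^bsub>P\<^esub> g) \<otimes>\<^bsub>P\<^esub> v)
            = (\<ominus>\<^bsub>S\<^esub> (Eval p \<otimes>\<^bsub>S\<^esub> Eval g)) \<otimes>\<^bsub>S\<^esub> Eval v"
          using less.prems g v by (simp add: S.l_minus S.r_minus S.m_assoc)
        ultimately have "Eval p \<otimes>\<^bsub>S\<^esub> Eval ((\<ominus>\<^bsub>P\<^esub> g) \<otimes>\<^bsub>P\<^esub> v) = h c"
          using eq by simp
        with v c g show ?thesis
          by (meson P.a_inv_closed P.m_closed)
      qed
    qed
  qed
qed

text \<open>
  Over a domain \<open>R\<close> the relations of an algebraic element \<open>s\<close> need not be generated by one of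
  minimal degree, but they are after inverting its leading coefficient; this is harmless as long as \<open>\<phi>\<close> does
  not kill that coefficient. Hence a root of the specialised minimal relation satisfies the
  specialisation of every relation.
\<close>

lemma (in UP_univ_prop) kernel_specialises:
  assumes T: "domain T" and \<phi>: "\<phi> \<in> ring_hom R T" and \<xi>: "\<xi> \<in> carrier T"
    and f: "f \<in> carrier P" "f \<noteq> \<zero>\<^bsub>P\<^esub>" "Eval f = \<zero>\<^bsub>S\<^esub>"
    and min: "\<And>g. \<lbrakk>g \<in> carrier P; Eval g = \<zero>\<^bsub>S\<^esub>; deg R g < deg R f\<rbrakk> \<Longrightarrow> g = \<zero>\<^bsub>P\<^esub>"
    and root: "UnivPoly.eval R T \<phi> \<xi> f = \<zero>\<^bsub>T\<^esub>"
    and lc: "\<phi> (UnivPoly.coeff P f (deg R f)) \<noteq> \<zero>\<^bsub>T\<^esub>"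
    and q: "q \<in> carrier P" "Eval q = \<zero>\<^bsub>S\<^esub>"
  shows "UnivPoly.eval R T \<phi> \<xi> q = \<zero>\<^bsub>T\<^esub>"
proof -
  interpret T: domain T by fact
  interpret e: UP_univ_prop R T \<phi> P \<xi> "UnivPoly.eval R T \<phi> \<xi>"
    by unfold_locales (use \<phi> \<xi> P_def in auto)
  let ?l = "UnivPoly.coeff P f (deg R f)"
  obtain g r and k :: nat where g: "g \<in> carrier P" and r: "r \<in> carrier P"
    and div: "?l [^] k \<odot>\<^bsub>P\<^esub> q = f \<otimes>\<^bsub>P\<^esub> g \<oplus>\<^bsub>P\<^esub> r"
    and deg: "r = \<zero>\<^bsub>P\<^esub> \<or> deg R r < deg R f"
    using long_div_theorem[OF f(1) q(1) f(2)] by blast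
  have l: "?l [^] k \<in> carrier R" using f by simp
  have "Eval (?l [^] k \<odot>\<^bsub>P\<^esub> q) = \<zero>\<^bsub>S\<^esub>"
    using eval_smult[OF indet_img_carrier l q(1)] q l by (simp add: Eval_def[symmetric])
  then have "Eval r = \<zero>\<^bsub>S\<^esub>"
    using div f g r by simp
  with min[OF r] deg have "r = \<zero>\<^bsub>P\<^esub>" by auto
  then have "UnivPoly.eval R T \<phi> \<xi> (?l [^] k \<odot>\<^bsub>P\<^esub> q) = \<zero>\<^bsub>T\<^esub>"
    using div f g root by simp
  then have "\<phi> ?l [^]\<^bsub>T\<^esub> k \<otimes>\<^bsub>T\<^esub> UnivPoly.eval R T \<phi> \<xi> q = \<zero>\<^bsub>T\<^esub>"
    using e.eval_smult[OF \<xi> l q(1)] f by (simp add: e.hom_pow)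
  moreover have "\<phi> ?l [^]\<^bsub>T\<^esub> k \<noteq> \<zero>\<^bsub>T\<^esub>"
    using lc f by (simp add: T.nat_pow_nonzero)
  moreover have "UnivPoly.eval R T \<phi> \<xi> q \<in> carrier T" "\<phi> ?l [^]\<^bsub>T\<^esub> k \<in> carrier T"
    using ring_hom_closed[OF e.eval_ring_hom[OF \<xi>] q(1)] ring_hom_closed[OF \<phi>] f by simp_all
  ultimately show ?thesis
    using T.integral by blast
qed

text \<open>
  The induction step of the Nullstellensatz. Homomorphisms from \<open>A\<close> to \<open>C\<close> do not always extend to
  \<open>A[x]\<close>, so the statement to be propagated is that for each nonzero element there is a homomorphism
  that does not vanish on it: this freedom allows one to avoid the finitely many denominators that
  an extension to \<open>A[x]\<close> meets.
\<close>

lemma nonvanishing_hom_extends_to_adjoin: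
  assumes K: "domain K" and A: "subring A K" and x: "x \<in> carrier K"
    and C: "algebraically_closed C" and QA: "Q \<subseteq> A"
    and ext: "\<And>b. \<lbrakk>b \<in> A; b \<noteq> \<zero>\<^bsub>K\<^esub>\<rbrakk>
      \<Longrightarrow> \<exists>\<phi>\<in>ring_hom (K\<lparr>carrier := A\<rparr>) C. (\<forall>q\<in>Q. \<phi> q = i q) \<and> \<phi> b \<noteq> \<zero>\<^bsub>C\<^esub>"
  shows "\<exists>A'. subring A' K \<and> A \<subseteq> A' \<and> x \<in> A' \<and>
    (\<forall>b\<in>A'. b \<noteq> \<zero>\<^bsub>K\<^esub> \<longrightarrow>
      (\<exists>\<psi>\<in>ring_hom (K\<lparr>carrier := A'\<rparr>) C. (\<forall>q\<in>Q. \<psi> q = i q) \<and> \<psi> b \<noteq> \<zero>\<^bsub>C\<^esub>))"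
proof -
  interpret K: domain K by fact
  interpret C: algebraically_closed C by fact
  define R where "R = K\<lparr>carrier := A\<rparr>"
  define P where "P = UP R"
  define ev where "ev = UnivPoly.eval R K id x"
  have AK: "A \<subseteq> carrier K" using subringE(1)[OF A] .
  interpret R: domain R
    unfolding R_def using K.subring_is_domain[OF A] .
  have R_simps [simp]: "carrier R = A" "\<zero>\<^bsub>R\<^esub> = \<zero>\<^bsub>K\<^esub>" "\<one>\<^bsub>R\<^esub> = \<one>\<^bsub>K\<^esub>"
    by (simp_all add: R_def)
  have id: "id \<in> ring_hom R K"
    by (rule ring_hom_memI) (use AK in \<open>auto simp: R_def\<close>)
  interpret D: UP_domain R P
    by unfold_locales (simp add: P_def)
  interpret ev: UP_univ_prop R K id P x ev
    using id x by unfold_locales (simp_all add: ev_def)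
  have evhom: "ev \<in> ring_hom P K"
    using ev.eval_ring_hom[OF x] by (simp add: ev_def)
  define A' where "A' = ev ` carrier P"
  have "subring A' K"
    unfolding A'_def
    by (intro ring_hom_ring.img_is_subring[OF ring_hom_ringI2[OF D.P.ring_axioms K.ring_axioms evhom]]
        ring.carrier_is_subring D.P.ring_axioms)
  moreover have const: "ev (UnivPoly.monom P a 0) = a" "a \<in> A'" if "a \<in> A" for a
  proof -
    show *: "ev (UnivPoly.monom P a 0) = a"
      using ev.eval_const[OF x, of a] that by (simp add: ev_def)
    show "a \<in> A'"
      unfolding A'_def using that by (intro image_eqI[of _ ev, OF *[symmetric]]) simp
  qed
  moreover have "x \<in> A'"
  proof -
    have "ev (UnivPoly.monom P \<one>\<^bsub>R\<^esub> 1) = x" using ev.eval_monom1[OF x] by (simp add: ev_def)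
    then show ?thesis
      unfolding A'_def by (metis D.monom_closed R.one_closed imageI)
  qed
  moreover have "\<exists>\<psi>\<in>ring_hom (K\<lparr>carrier := A'\<rparr>) C. (\<forall>q\<in>Q. \<psi> q = i q) \<and> \<psi> b \<noteq> \<zero>\<^bsub>C\<^esub>"
    if b: "b \<in> A'" "b \<noteq> \<zero>\<^bsub>K\<^esub>" for b
  proof -
    obtain p where p: "p \<in> carrier P" "b = ev p" using b unfolding A'_def by blast
    have "\<exists>\<phi> \<xi>. \<phi> \<in> ring_hom R C \<and> (\<forall>q\<in>Q. \<phi> q = i q) \<and> \<xi> \<in> carrier C \<and>
       (\<forall>q\<in>carrier P. ev q = \<zero>\<^bsub>K\<^esub> \<longrightarrow> UnivPoly.eval R C \<phi> \<xi> q = \<zero>\<^bsub>C\<^esub>) \<and>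
       UnivPoly.eval R C \<phi> \<xi> p \<noteq> \<zero>\<^bsub>C\<^esub>"
    proof (cases "\<exists>f\<in>carrier P. f \<noteq> \<zero>\<^bsub>P\<^esub> \<and> ev f = \<zero>\<^bsub>K\<^esub>")
      case True
      then obtain f where f: "f \<in> carrier P" "f \<noteq> \<zero>\<^bsub>P\<^esub>" "ev f = \<zero>\<^bsub>K\<^esub>"
        and min': "\<And>g. g \<in> carrier P \<and> g \<noteq> \<zero>\<^bsub>P\<^esub> \<and> ev g = \<zero>\<^bsub>K\<^esub> \<Longrightarrow> deg R f \<le> deg R g"
        using ex_has_least_nat[of "\<lambda>f. f \<in> carrier P \<and> f \<noteq> \<zero>\<^bsub>P\<^esub> \<and> ev f = \<zero>\<^bsub>K\<^esub>" _ "deg R"]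
        by blast
      have min: "g = \<zero>\<^bsub>P\<^esub>" if "g \<in> carrier P" "ev g = \<zero>\<^bsub>K\<^esub>" "deg R g < deg R f" for g
        using min'[of g] that by force
      let ?l = "UnivPoly.coeff P f (deg R f)"
      have l: "?l \<in> A" "?l \<noteq> \<zero>\<^bsub>K\<^esub>"
        using D.coeff_closed[OF f(1)] D.lcoeff_nonzero[OF f(2,1)] by simp_all
      obtain v c where v: "v \<in> carrier P" and c: "c \<in> A" "c \<noteq> \<zero>\<^bsub>K\<^esub>" and pv: "ev p \<otimes>\<^bsub>K\<^esub> ev v = c"
        using ev.nonzero_multiple_in_base[OF R.domain_axioms K inj_on_id f min p(1)] b(2) p(2)
        by (simp add: Bex_def) blast
      \<comment> \<open>If \<open>x\<close> is algebraic, \<open>\<phi>\<close> must not vanish on the leading coefficient of the minimal relation, so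
        that \<open>\<phi>\<close> extends, nor on a multiple of \<open>b\<close> in \<open>A\<close>, so that the extension does not vanish on \<open>b\<close>.\<close>
      have lc: "?l \<otimes>\<^bsub>K\<^esub> c \<in> A" "?l \<otimes>\<^bsub>K\<^esub> c \<noteq> \<zero>\<^bsub>K\<^esub>"
        using subringE(6)[OF A l(1) c(1)] K.integral[of ?l c] l c AK by auto
      then obtain \<phi> where \<phi>: "\<phi> \<in> ring_hom R C" "\<forall>q\<in>Q. \<phi> q = i q" "\<phi> (?l \<otimes>\<^bsub>K\<^esub> c) \<noteq> \<zero>\<^bsub>C\<^esub>"
        using ext R_def by blast
      have "\<phi> (?l \<otimes>\<^bsub>K\<^esub> c) = \<phi> ?l \<otimes>\<^bsub>C\<^esub> \<phi> c"
        using ring_hom_mult[OF \<phi>(1), of ?l c] l c by (simp add: R_def)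
      moreover have "\<phi> ?l \<in> carrier C" "\<phi> c \<in> carrier C"
        using ring_hom_closed[OF \<phi>(1)] l c by simp_all
      ultimately have nz: "\<phi> ?l \<noteq> \<zero>\<^bsub>C\<^esub>" "\<phi> c \<noteq> \<zero>\<^bsub>C\<^esub>"
        using \<phi>(3) by auto
      have "deg R f \<noteq> 0"
      proof
        assume "deg R f = 0"
        then have "f = UnivPoly.monom P ?l 0"
          using D.deg_zero_impl_monom[OF f(1)] by simp
        then show False
          using const(1)[OF l(1)] f(3) l(2) by simp
      qed
      then obtain \<xi> where \<xi>: "\<xi> \<in> carrier C" "UnivPoly.eval R C \<phi> \<xi> f = \<zero>\<^bsub>C\<^esub>"
        using algebraically_closed_root[OF C R.is_cring \<phi>(1)] f(1) nz(1) unfolding P_def by blast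
      interpret e: UP_univ_prop R C \<phi> P \<xi> "UnivPoly.eval R C \<phi> \<xi>"
        using \<phi>(1) \<xi>(1) by unfold_locales
      have ker: "UnivPoly.eval R C \<phi> \<xi> q = \<zero>\<^bsub>C\<^esub>" if "q \<in> carrier P" "ev q = \<zero>\<^bsub>K\<^esub>" for q
        using ev.kernel_specialises[OF C.domain_axioms \<phi>(1) \<xi>(1) f min \<xi>(2) nz(1) that] .
      have "ev (p \<otimes>\<^bsub>P\<^esub> v \<ominus>\<^bsub>P\<^esub> UnivPoly.monom P c 0) = \<zero>\<^bsub>K\<^esub>"
        using p v c pv const(1)[OF c(1)] AK by (auto simp: a_minus_def K.r_neg)
      then have "UnivPoly.eval R C \<phi> \<xi> (p \<otimes>\<^bsub>P\<^esub> v \<ominus>\<^bsub>P\<^esub> UnivPoly.monom P c 0) = \<zero>\<^bsub>C\<^esub>"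
        using ker p v c by simp
      then have "UnivPoly.eval R C \<phi> \<xi> p \<otimes>\<^bsub>C\<^esub> UnivPoly.eval R C \<phi> \<xi> v \<ominus>\<^bsub>C\<^esub> \<phi> c = \<zero>\<^bsub>C\<^esub>"
        using p v c e.eval_const[OF \<xi>(1), of c] by (simp add: a_minus_def)
      with nz(2) p v c have "UnivPoly.eval R C \<phi> \<xi> p \<noteq> \<zero>\<^bsub>C\<^esub>"
        using ring_hom_closed[OF \<phi>(1), of c] by (auto simp: a_minus_def)
      with \<phi> \<xi>(1) ker show ?thesis by blast
    next
      case False
      let ?l = "UnivPoly.coeff P p (deg R p)"
      \<comment> \<open>If \<open>x\<close> is transcendental, \<open>\<phi>\<close> extends with any value at \<open>x\<close>; it remains to choose one that is no
        root of the specialisation of \<open>p\<close>.\<close>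
      have p0: "p \<noteq> \<zero>\<^bsub>P\<^esub>" using p b ev.hom_zero by auto
      have l: "?l \<in> A" "?l \<noteq> \<zero>\<^bsub>K\<^esub>"
        using D.coeff_closed[OF p(1)] D.lcoeff_nonzero[OF p0 p(1)] by simp_all
      then obtain \<phi> where \<phi>: "\<phi> \<in> ring_hom R C" "\<forall>q\<in>Q. \<phi> q = i q" "\<phi> ?l \<noteq> \<zero>\<^bsub>C\<^esub>"
        using ext R_def by blast
      have "\<exists>\<xi>\<in>carrier C. UnivPoly.eval R C \<phi> \<xi> p \<noteq> \<zero>\<^bsub>C\<^esub>"
      proof (cases "deg R p = 0")
        case True
        obtain \<xi> where \<xi>: "\<xi> \<in> carrier C" using C.one_closed by blast
        interpret e: UP_univ_prop R C \<phi> P \<xi> "UnivPoly.eval R C \<phi> \<xi>"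
          using \<phi>(1) \<xi> by unfold_locales
        have mon: "UnivPoly.monom P ?l 0 = p"
          unfolding True by (rule D.deg_zero_impl_monom[OF p(1) True, symmetric])
        have "UnivPoly.eval R C \<phi> \<xi> (UnivPoly.monom P ?l 0) = \<phi> ?l"
          using l(1) by (intro e.eval_const[OF \<xi>]) simp
        then have "UnivPoly.eval R C \<phi> \<xi> p = \<phi> ?l"
          unfolding mon .
        with \<phi>(3) \<xi> show ?thesis by (intro bexI[of _ \<xi>]) simp_all
      next
        case pos: False
        \<comment> \<open>A root of \<open>p - 1\<close> is not a root of \<open>p\<close>.\<close>
        define f where "f = p \<ominus>\<^bsub>P\<^esub> \<one>\<^bsub>P\<^esub>"
        have f: "f \<in> carrier P" using p by (simp add: f_def)
        have cf: "UnivPoly.coeff P f n = UnivPoly.coeff P p n" if "n \<noteq> 0" for n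
          using p(1) that by (simp add: f_def a_minus_def del: R_simps)
        have df: "deg R f = deg R p"
        proof (rule le_antisym)
          show "deg R f \<le> deg R p"
          proof (rule D.deg_aboveI[OF _ f])
            show "UnivPoly.coeff P f m = \<zero>\<^bsub>R\<^esub>" if "deg R p < m" for m
              using cf[of m] D.deg_aboveD[OF that p(1)] that by simp
          qed
          show "deg R p \<le> deg R f"
          proof (rule D.deg_belowI[OF _ f])
            show "UnivPoly.coeff P f (deg R p) \<noteq> \<zero>\<^bsub>R\<^esub>"
              using cf[OF pos] l by simp
          qed
        qed
        obtain \<xi> where \<xi>: "\<xi> \<in> carrier C" "UnivPoly.eval R C \<phi> \<xi> f = \<zero>\<^bsub>C\<^esub>"
          using algebraically_closed_root[OF C R.is_cring \<phi>(1), of f] f df pos cf[OF pos] \<phi>(3)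
          unfolding P_def by auto
        interpret e: UP_univ_prop R C \<phi> P \<xi> "UnivPoly.eval R C \<phi> \<xi>"
          using \<phi>(1) \<xi>(1) by unfold_locales
        have "UnivPoly.eval R C \<phi> \<xi> p \<ominus>\<^bsub>C\<^esub> \<one>\<^bsub>C\<^esub> = \<zero>\<^bsub>C\<^esub>"
          using \<xi>(2) p by (simp add: f_def a_minus_def)
        then have "UnivPoly.eval R C \<phi> \<xi> p \<noteq> \<zero>\<^bsub>C\<^esub>"
          by (auto simp: a_minus_def)
        with \<xi>(1) show ?thesis by blast
      qed
      then obtain \<xi> where \<xi>: "\<xi> \<in> carrier C" "UnivPoly.eval R C \<phi> \<xi> p \<noteq> \<zero>\<^bsub>C\<^esub>" by blast
      interpret e: UP_univ_prop R C \<phi> P \<xi> "UnivPoly.eval R C \<phi> \<xi>"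
        using \<phi>(1) \<xi>(1) by unfold_locales
      have "UnivPoly.eval R C \<phi> \<xi> q = \<zero>\<^bsub>C\<^esub>" if "q \<in> carrier P" "ev q = \<zero>\<^bsub>K\<^esub>" for q
        using False that by auto
      with \<phi> \<xi> show ?thesis by blast
    qed
    then obtain \<phi> \<xi> where \<phi>: "\<phi> \<in> ring_hom R C" "\<forall>q\<in>Q. \<phi> q = i q" and \<xi>: "\<xi> \<in> carrier C"
      and ker: "\<And>q. \<lbrakk>q \<in> carrier P; ev q = \<zero>\<^bsub>K\<^esub>\<rbrakk> \<Longrightarrow> UnivPoly.eval R C \<phi> \<xi> q = \<zero>\<^bsub>C\<^esub>"
      and nz: "UnivPoly.eval R C \<phi> \<xi> p \<noteq> \<zero>\<^bsub>C\<^esub>" by blast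
    interpret e: UP_univ_prop R C \<phi> P \<xi> "UnivPoly.eval R C \<phi> \<xi>"
      using \<phi>(1) \<xi>(1) by unfold_locales
    obtain \<psi> where \<psi>: "\<psi> \<in> ring_hom (K\<lparr>carrier := ev ` carrier P\<rparr>) C"
      "\<And>q. q \<in> carrier P \<Longrightarrow> \<psi> (ev q) = UnivPoly.eval R C \<phi> \<xi> q"
      using ring_hom_factor[OF D.P.ring_axioms K.ring_axioms C.ring_axioms evhom e.eval_ring_hom[OF \<xi>]] ker by blast
    have "\<psi> q = i q" if "q \<in> Q" for q
      using \<psi>(2)[of "UnivPoly.monom P q 0"] const(1)[of q] that QA \<phi>(2) e.eval_const[OF \<xi>, of q] by auto
    with \<psi> p nz show ?thesis
      unfolding A'_def[symmetric] by metis
  qed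
  ultimately show ?thesis by blast
qed

text \<open>
  The Nullstellensatz, in the form in which it transports solutions of polynomial equations: if the
  coefficients lie in \<open>Q\<close> and the solution in \<open>E\<close>, then the image of the solution under \<open>\<psi>\<close> solves
  the same equations in \<open>C\<close>.
\<close>

lemma partial_hom_to_algebraically_closed:
  assumes K: "domain K" and Q: "subfield Q K"
    and C: "algebraically_closed C" and i: "i \<in> ring_hom (K\<lparr>carrier := Q\<rparr>) C"
    and E: "finite E" "E \<subseteq> carrier K"
  obtains A \<psi> where "subring A K" and "Q \<subseteq> A" and "E \<subseteq> A"
    and "\<psi> \<in> ring_hom (K\<lparr>carrier := A\<rparr>) C" and "\<And>q. q \<in> Q \<Longrightarrow> \<psi> q = i q"
proof -
  interpret K: domain K by fact
  interpret C: algebraically_closed C by fact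
  have "\<exists>A. subring A K \<and> Q \<subseteq> A \<and> E \<subseteq> A \<and>
    (\<forall>b\<in>A. b \<noteq> \<zero>\<^bsub>K\<^esub> \<longrightarrow>
      (\<exists>\<psi>\<in>ring_hom (K\<lparr>carrier := A\<rparr>) C. (\<forall>q\<in>Q. \<psi> q = i q) \<and> \<psi> b \<noteq> \<zero>\<^bsub>C\<^esub>))"
    using E
  proof (induction E rule: finite_induct)
    case empty
    interpret Q: field "K\<lparr>carrier := Q\<rparr>" using K.subfield_iff(2)[OF Q] .
    interpret i: ring_hom_ring "K\<lparr>carrier := Q\<rparr>" C i
      using i Q.ring_axioms C.ring_axioms by (simp add: ring_hom_ringI2)
    have "i b \<noteq> \<zero>\<^bsub>C\<^esub>" if "b \<in> Q" "b \<noteq> \<zero>\<^bsub>K\<^esub>" for b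
    proof
      assume "i b = \<zero>\<^bsub>C\<^esub>"
      have "b \<in> Units (K\<lparr>carrier := Q\<rparr>)" using that Q.field_Units by simp
      then obtain c where "c \<in> Q" "b \<otimes>\<^bsub>K\<^esub> c = \<one>\<^bsub>K\<^esub>" by (auto simp: Units_def)
      then have "i b \<otimes>\<^bsub>C\<^esub> i c = \<one>\<^bsub>C\<^esub>"
        using i.hom_mult[of b c] i.hom_one that by simp
      with \<open>i b = \<zero>\<^bsub>C\<^esub>\<close> \<open>c \<in> Q\<close> show False
        using i.hom_closed[of c] by simp
    qed
    with i show ?case
      using subfieldE(1)[OF Q] by auto
  next
    case (insert x E)
    then obtain A where A: "subring A K" "Q \<subseteq> A" "E \<subseteq> A"
      and ext: "\<And>b. \<lbrakk>b \<in> A; b \<noteq> \<zero>\<^bsub>K\<^esub>\<rbrakk>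
        \<Longrightarrow> \<exists>\<psi>\<in>ring_hom (K\<lparr>carrier := A\<rparr>) C. (\<forall>q\<in>Q. \<psi> q = i q) \<and> \<psi> b \<noteq> \<zero>\<^bsub>C\<^esub>"
      by auto
    have "x \<in> carrier K" using insert by simp
    from nonvanishing_hom_extends_to_adjoin[OF K A(1) this C A(2) ext]
    obtain A' where "subring A' K" "A \<subseteq> A'" "x \<in> A'"
      "\<forall>b\<in>A'. b \<noteq> \<zero>\<^bsub>K\<^esub> \<longrightarrow>
      (\<exists>\<psi>\<in>ring_hom (K\<lparr>carrier := A'\<rparr>) C. (\<forall>q\<in>Q. \<psi> q = i q) \<and> \<psi> b \<noteq> \<zero>\<^bsub>C\<^esub>)"
      by auto
    with A show ?case
      by (intro exI[of _ A']) auto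
  qed
  then obtain A where A: "subring A K" "Q \<subseteq> A" "E \<subseteq> A"
      and ext: "\<And>b. \<lbrakk>b \<in> A; b \<noteq> \<zero>\<^bsub>K\<^esub>\<rbrakk>
        \<Longrightarrow> \<exists>\<psi>\<in>ring_hom (K\<lparr>carrier := A\<rparr>) C. (\<forall>q\<in>Q. \<psi> q = i q) \<and> \<psi> b \<noteq> \<zero>\<^bsub>C\<^esub>"
    by auto
  from ext[of "\<one>\<^bsub>K\<^esub>"] subringE(3)[OF A(1)] K.one_not_zero A that show thesis by blast
qed

section \<open>Additive maps and tensor products over the integers\<close>

lemma additive_map_zero:
  assumes "abelian_group M" "abelian_group G" "f \<in> hom (add_monoid M) (add_monoid G)"
  shows "f \<zero>\<^bsub>M\<^esub> = \<zero>\<^bsub>G\<^esub>"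
  using hom_one[OF assms(3) abelian_group.a_group[OF assms(1)] abelian_group.a_group[OF assms(2)]]
  by simp

lemma additive_map_closed:
  "\<lbrakk>f \<in> hom (add_monoid M) (add_monoid G); x \<in> carrier M\<rbrakk> \<Longrightarrow> f x \<in> carrier G"
  by (auto simp: hom_def)

lemma additive_map_add:
  "\<lbrakk>f \<in> hom (add_monoid M) (add_monoid G); x \<in> carrier M; y \<in> carrier M\<rbrakk>
    \<Longrightarrow> f (x \<oplus>\<^bsub>M\<^esub> y) = f x \<oplus>\<^bsub>G\<^esub> f y"
  by (auto simp: hom_def)

lemma additive_map_finsum:
  assumes M: "abelian_group M" and G: "abelian_group G"
    and f: "f \<in> hom (add_monoid M) (add_monoid G)"
    and g: "g \<in> I \<rightarrow> carrier M"
  shows "f (finsum M g I) = (\<Oplus>\<^bsub>G\<^esub>i\<in>I. f (g i))"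
proof -
  interpret M: abelian_group M by fact
  interpret G: abelian_group G by fact
  show ?thesis
    using g
  proof (induction I rule: infinite_finite_induct)
    case (insert i I)
    then have "g \<in> I \<rightarrow> carrier M" "g i \<in> carrier M" by auto
    moreover from this have "(\<lambda>i. f (g i)) \<in> I \<rightarrow> carrier G" "f (g i) \<in> carrier G"
      using additive_map_closed[OF f] by auto
    ultimately show ?case
      using insert additive_map_add[OF f, of "g i" "finsum M g I"] by simp
  qed (simp_all add: additive_map_zero[OF M G f])
qed

definition pure_tensor :: "('v, 'b) module \<Rightarrow> 'u ring \<Rightarrow> 'b \<Rightarrow> 'u \<Rightarrow> ('b \<times> 'u \<Rightarrow>\<^sub>0 int) set" where
  "pure_tensor A R a r = tensor_coset A R (frag_of (a, r))"

lemma relator_left: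
  "\<lbrakk>a \<in> carrier A; a' \<in> carrier A; r \<in> carrier R\<rbrakk>
    \<Longrightarrow> frag_of (a \<oplus>\<^bsub>A\<^esub> a', r) - frag_of (a, r) - frag_of (a', r) \<in> tensor_relators A R"
  unfolding tensor_relators_def by blast

lemma relator_right:
  "\<lbrakk>a \<in> carrier A; r \<in> carrier R; r' \<in> carrier R\<rbrakk>
    \<Longrightarrow> frag_of (a, r \<oplus>\<^bsub>R\<^esub> r') - frag_of (a, r) - frag_of (a, r') \<in> tensor_relators A R"
  unfolding tensor_relators_def by blast

lemma tensor_relators_cases:
  assumes "k \<in> tensor_relators A R"
  obtains (left) a a' r where "a \<in> carrier A" "a' \<in> carrier A" "r \<in> carrier R"
      "k = frag_of (a \<oplus>\<^bsub>A\<^esub> a', r) - frag_of (a, r) - frag_of (a', r)"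
    | (right) a r r' where "a \<in> carrier A" "r \<in> carrier R" "r' \<in> carrier R"
      "k = frag_of (a, r \<oplus>\<^bsub>R\<^esub> r') - frag_of (a, r) - frag_of (a, r')"
  using assms unfolding tensor_relators_def by blast

locale tensor_product = A: abelian_group A + R: cring R
  for A :: "('v, 'b) module" and R :: "'u ring"
begin

abbreviation "Fr \<equiv> tensor_free A R"
abbreviation "Kr \<equiv> tensor_ker A R"
abbreviation "T \<equiv> tensor_algebra A R"

sublocale Fr: comm_group Fr
  by (rule abelian_free_Abelian_group)

lemma relators_subset: "tensor_relators A R \<subseteq> carrier Fr"
  unfolding tensor_relators_def
  by (auto dest!: subsetD[OF keys_diff])

lemma ker_subgroup: "subgroup Kr Fr"
  unfolding tensor_ker_def by (rule Fr.generate_is_subgroup[OF relators_subset])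

lemma ker_normal: "Kr \<lhd> Fr"
  by (rule Fr.subgroup_imp_normal[OF ker_subgroup])

lemma coset_mem: "x \<in> carrier Fr \<Longrightarrow> y \<in> tensor_coset A R x \<longleftrightarrow> (\<exists>k\<in>Kr. y = k + x)"
  by (auto simp: tensor_coset_def r_coset_def)

lemma coset_self: "x \<in> carrier Fr \<Longrightarrow> x \<in> tensor_coset A R x"
  unfolding tensor_coset_def by (rule Fr.rcos_self[OF _ ker_subgroup])

lemma coset_eqI:
  assumes "x \<in> carrier Fr" "y \<in> carrier Fr" "x - y \<in> Kr"
  shows "tensor_coset A R x = tensor_coset A R y"
proof -
  have "x \<in> tensor_coset A R y"
    using assms coset_mem[of y x] by (intro iffD2[OF coset_mem] bexI[of _ "x - y"]) auto
  then show ?thesis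
    unfolding tensor_coset_def using Fr.repr_independence[OF _ assms(2) ker_subgroup] by simp
qed

lemma carrier_tensor: "carrier T = tensor_coset A R ` carrier Fr"
  by (auto simp: tensor_algebra_def carrier_FactGroup tensor_coset_def)

lemma add_coset:
  assumes "x \<in> carrier Fr" "y \<in> carrier Fr"
  shows "tensor_coset A R x \<oplus>\<^bsub>T\<^esub> tensor_coset A R y = tensor_coset A R (x + y)"
  using normal.rcos_sum[OF ker_normal assms]
  by (simp add: tensor_algebra_def tensor_coset_def)

lemma pure_closed: "\<lbrakk>a \<in> carrier A; r \<in> carrier R\<rbrakk> \<Longrightarrow> pure_tensor A R a r \<in> carrier T"
  by (auto simp: carrier_tensor pure_tensor_def)

lemma pure_add_left:
  assumes "a \<in> carrier A" "a' \<in> carrier A" "r \<in> carrier R"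
  shows "pure_tensor A R (a \<oplus>\<^bsub>A\<^esub> a') r = pure_tensor A R a r \<oplus>\<^bsub>T\<^esub> pure_tensor A R a' r"
proof -
  have k: "Poly_Mapping.keys (frag_of (a, r) + frag_of (a', r)) \<subseteq> carrier A \<times> carrier R"
    using assms keys_add[of "frag_of (a, r)" "frag_of (a', r)"] by auto
  have "frag_of (a \<oplus>\<^bsub>A\<^esub> a', r) - (frag_of (a, r) + frag_of (a', r)) \<in> Kr"
    unfolding tensor_ker_def tensor_relators_def
    by (rule generate.incl) (use assms in \<open>auto simp: diff_diff_eq\<close>)
  then have "tensor_coset A R (frag_of (a \<oplus>\<^bsub>A\<^esub> a', r))
      = tensor_coset A R (frag_of (a, r) + frag_of (a', r))"
    using assms k by (intro coset_eqI) simp_all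
  then show ?thesis
    using assms by (simp add: pure_tensor_def add_coset)
qed

lemma pure_add_right:
  assumes "a \<in> carrier A" "r \<in> carrier R" "r' \<in> carrier R"
  shows "pure_tensor A R a (r \<oplus>\<^bsub>R\<^esub> r') = pure_tensor A R a r \<oplus>\<^bsub>T\<^esub> pure_tensor A R a r'"
proof -
  have k: "Poly_Mapping.keys (frag_of (a, r) + frag_of (a, r')) \<subseteq> carrier A \<times> carrier R"
    using assms keys_add[of "frag_of (a, r)" "frag_of (a, r')"] by auto
  have "frag_of (a, r \<oplus>\<^bsub>R\<^esub> r') - (frag_of (a, r) + frag_of (a, r')) \<in> Kr"
    unfolding tensor_ker_def tensor_relators_def
    by (rule generate.incl) (use assms in \<open>auto simp: diff_diff_eq\<close>)
  then have "tensor_coset A R (frag_of (a, r \<oplus>\<^bsub>R\<^esub> r'))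
      = tensor_coset A R (frag_of (a, r) + frag_of (a, r'))"
    using assms k by (intro coset_eqI) simp_all
  then show ?thesis
    using assms by (simp add: pure_tensor_def add_coset)
qed

text \<open>
  The relators generate the kernel. For the universal property \<open>N\<close> is the trivial subgroup; for maps
  between tensor products it is the kernel that defines the target.
\<close>

lemma additive_map_kills_ker:
  assumes G: "group G" and h: "h \<in> hom Fr G"
    and rel: "\<And>k. k \<in> tensor_relators A R \<Longrightarrow> h k \<in> N" and N: "subgroup N G"
    and k: "k \<in> Kr"
  shows "h k \<in> N"
proof -
  interpret h: group_hom Fr G h
    using G h by (simp add: group_hom_def group_hom_axioms_def Fr.is_group)
  interpret N: subgroup N G by fact
  from k show ?thesis
    unfolding tensor_ker_def
  proof (induction rule: generate.induct)
    case one
    then show ?case using h.hom_one N.one_closed by simp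
  next
    case (inv x)
    then show ?case using rel relators_subset N.m_inv_closed h.hom_inv[of x] by auto
  next
    case (eng x y)
    then show ?case
      using h.hom_mult[of x y] N.m_closed[of "h x" "h y"]
        Fr.generate_in_carrier[OF relators_subset] by auto
  qed (rule rel)
qed

lemma frag_extend_hom:
  assumes "\<And>a r. \<lbrakk>a \<in> carrier A; r \<in> carrier R\<rbrakk> \<Longrightarrow> f (a, r) \<in> carrier (free_Abelian_group S)"
  shows "frag_extend f \<in> hom Fr (free_Abelian_group S)"
proof (rule homI)
  fix x assume "x \<in> carrier Fr"
  then have "Poly_Mapping.keys (f z) \<subseteq> S" if "z \<in> Poly_Mapping.keys x" for z
    using that assms[of "fst z" "snd z"] by (cases z) (auto simp: subset_iff)
  then show "frag_extend f x \<in> carrier (free_Abelian_group S)"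
    using keys_frag_extend[of f x] by fastforce
qed (simp add: frag_extend_add)

text \<open>
  The operations on the tensor product are unions over all representatives of a coset; all of them
  contribute the same coset if the underlying map respects the kernels.
\<close>

lemma UN_coset:
  assumes h: "h \<in> hom Fr (tensor_free A' S)"
    and A': "tensor_product A' S"
    and rel: "\<And>k. k \<in> tensor_relators A R \<Longrightarrow> h k \<in> tensor_ker A' S"
    and x: "x \<in> carrier Fr"
  shows "(\<Union>y\<in>tensor_coset A R x. tensor_coset A' S (h y)) = tensor_coset A' S (h x)"
proof -
  interpret T': tensor_product A' S by fact
  have "tensor_coset A' S (h y) = tensor_coset A' S (h x)" if y: "y \<in> tensor_coset A R x" for y
  proof -
    obtain k where k: "k \<in> Kr" "y = k + x" using y coset_mem[OF x] by blast
    have kF: "k \<in> carrier Fr" using k subgroup.subset[OF ker_subgroup] by blast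
    have hk: "h k \<in> tensor_ker A' S"
      by (rule additive_map_kills_ker[OF T'.Fr.is_group h rel T'.ker_subgroup k(1)])
    have hy: "h y = h k + h x"
      using hom_mult[OF h kF x] k by simp
    have "h x \<in> carrier T'.Fr" "h k \<in> carrier T'.Fr"
      using hom_in_carrier[OF h] x kF by blast+
    then show ?thesis
      using hk T'.Fr.m_closed[of "h k" "h x"] unfolding hy
      by (intro T'.coset_eqI) (simp_all del: carrier_free_Abelian_group_iff)
  qed
  then show ?thesis using coset_self[OF x] by blast
qed

lemma smult_coset:
  assumes s: "s \<in> carrier R" and x: "x \<in> carrier Fr"
  shows "s \<odot>\<^bsub>T\<^esub> tensor_coset A R x = tensor_coset A R (frag_extend (\<lambda>(a, r). frag_of (a, s \<otimes>\<^bsub>R\<^esub> r)) x)"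
proof -
  have "frag_extend (\<lambda>(a, r). frag_of (a, s \<otimes>\<^bsub>R\<^esub> r)) k \<in> Kr" if "k \<in> tensor_relators A R" for k
  proof -
    have "frag_extend (\<lambda>(a, r). frag_of (a, s \<otimes>\<^bsub>R\<^esub> r)) k \<in> tensor_relators A R"
      using that
      by (cases rule: tensor_relators_cases)
        (use s in \<open>simp_all add: frag_extend_diff R.r_distr relator_left relator_right\<close>)
    then show ?thesis unfolding tensor_ker_def by (rule generate.incl)
  qed
  then show ?thesis
    using UN_coset[OF frag_extend_hom tensor_product_axioms _ x] s
    by (auto simp: tensor_algebra_def)
qed

lemma smult_pure:
  "\<lbrakk>s \<in> carrier R; a \<in> carrier A; r \<in> carrier R\<rbrakk>
    \<Longrightarrow> s \<odot>\<^bsub>T\<^esub> pure_tensor A R a r = pure_tensor A R a (s \<otimes>\<^bsub>R\<^esub> r)"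
  by (simp add: pure_tensor_def smult_coset)

lemma tensor_map_coset:
  assumes S: "cring S" and \<alpha>: "\<alpha> \<in> hom (add_monoid R) (add_monoid S)" and x: "x \<in> carrier Fr"
  shows "tensor_map A S \<alpha> (tensor_coset A R x)
    = tensor_coset A S (frag_extend (\<lambda>(a, r). frag_of (a, \<alpha> r)) x)"
proof -
  interpret S: cring S by fact
  have S': "tensor_product A S" ..
  have "frag_extend (\<lambda>(a, r). frag_of (a, \<alpha> r)) k \<in> tensor_ker A S" if "k \<in> tensor_relators A R" for k
  proof -
    have "frag_extend (\<lambda>(a, r). frag_of (a, \<alpha> r)) k \<in> tensor_relators A S"
      using that
      by (cases rule: tensor_relators_cases)
        (simp_all add: frag_extend_diff additive_map_add[OF \<alpha>] additive_map_closed[OF \<alpha>]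
          relator_left relator_right)
    then show ?thesis unfolding tensor_ker_def by (rule generate.incl)
  qed
  then show ?thesis
    using UN_coset[OF frag_extend_hom S' _ x] additive_map_closed[OF \<alpha>]
    by (auto simp: tensor_map_def)
qed

lemma tensor_map_pure:
  "\<lbrakk>cring S; \<alpha> \<in> hom (add_monoid R) (add_monoid S); a \<in> carrier A; r \<in> carrier R\<rbrakk>
    \<Longrightarrow> tensor_map A S \<alpha> (pure_tensor A R a r) = pure_tensor A S a (\<alpha> r)"
  by (simp add: pure_tensor_def tensor_map_coset)

text \<open>
  Negatives cost nothing because \<open>- (a \<otimes> r) = a \<otimes> (- r)\<close>, so that pure tensors generate the tensor
  product as a monoid.
\<close>

lemma tensor_induct:
  assumes u: "u \<in> carrier T"
    and pure: "\<And>a r. \<lbrakk>a \<in> carrier A; r \<in> carrier R\<rbrakk> \<Longrightarrow> P (pure_tensor A R a r)"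
    and add: "\<And>u v. \<lbrakk>u \<in> carrier T; v \<in> carrier T; P u; P v\<rbrakk> \<Longrightarrow> P (u \<oplus>\<^bsub>T\<^esub> v)"
  shows "P u"
proof -
  have zero: "pure_tensor A R a \<zero>\<^bsub>R\<^esub> = tensor_coset A R 0" if a: "a \<in> carrier A" for a
  proof -
    have "frag_of (a, \<zero>\<^bsub>R\<^esub> \<oplus>\<^bsub>R\<^esub> \<zero>\<^bsub>R\<^esub>) - frag_of (a, \<zero>\<^bsub>R\<^esub>) - frag_of (a, \<zero>\<^bsub>R\<^esub>) \<in> Kr"
      unfolding tensor_ker_def tensor_relators_def
      by (rule generate.incl) (use a in blast)
    then have "- frag_of (a, \<zero>\<^bsub>R\<^esub>) \<in> Kr" by simp
    from subgroup.m_inv_closed[OF ker_subgroup this] a have "frag_of (a, \<zero>\<^bsub>R\<^esub>) \<in> Kr"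
      by simp
    then show ?thesis
      unfolding pure_tensor_def using a by (intro coset_eqI) auto
  qed
  have neg: "tensor_coset A R (- frag_of (a, r)) = pure_tensor A R a (\<ominus>\<^bsub>R\<^esub> r)"
    if a: "a \<in> carrier A" "r \<in> carrier R" for a r
  proof -
    have "frag_of (a, r \<oplus>\<^bsub>R\<^esub> \<ominus>\<^bsub>R\<^esub> r) - frag_of (a, r) - frag_of (a, \<ominus>\<^bsub>R\<^esub> r) \<in> Kr"
      unfolding tensor_ker_def tensor_relators_def
      by (rule generate.incl) (use a in blast)
    then have 1: "frag_of (a, \<zero>\<^bsub>R\<^esub>) - frag_of (a, r) - frag_of (a, \<ominus>\<^bsub>R\<^esub> r) \<in> Kr"
      using a by (simp add: R.r_neg)
    have "- frag_of (a, \<zero>\<^bsub>R\<^esub>) \<in> Kr"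
    proof -
      have "frag_of (a, \<zero>\<^bsub>R\<^esub> \<oplus>\<^bsub>R\<^esub> \<zero>\<^bsub>R\<^esub>) - frag_of (a, \<zero>\<^bsub>R\<^esub>) - frag_of (a, \<zero>\<^bsub>R\<^esub>) \<in> Kr"
        unfolding tensor_ker_def tensor_relators_def
        by (rule generate.incl) (use a in blast)
      then show ?thesis by simp
    qed
    from subgroup.m_closed[OF ker_subgroup 1 this]
    have "- frag_of (a, r) - frag_of (a, \<ominus>\<^bsub>R\<^esub> r) \<in> Kr" by (simp add: algebra_simps)
    then show ?thesis
      unfolding pure_tensor_def using a by (intro coset_eqI) auto
  qed
  \<comment> \<open>The free group is generated under differences; proving the claim for \<open>x\<close> and \<open>- x\<close> together
    reduces differences to sums.\<close>
  have "P (tensor_coset A R x) \<and> P (tensor_coset A R (- x))" if x: "Poly_Mapping.keys x \<subseteq> carrier A \<times> carrier R" for x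
  proof (rule free_Abelian_group_induct[OF x])
    show "P (tensor_coset A R 0) \<and> P (tensor_coset A R (- 0))"
      using pure[OF A.zero_closed R.zero_closed] zero[OF A.zero_closed] by simp
  next
    fix x y
    assume k: "Poly_Mapping.keys x \<subseteq> carrier A \<times> carrier R"
        "Poly_Mapping.keys y \<subseteq> carrier A \<times> carrier R"
      and x: "P (tensor_coset A R x) \<and> P (tensor_coset A R (- x))"
      and y: "P (tensor_coset A R y) \<and> P (tensor_coset A R (- y))"
    have "P (tensor_coset A R (x + - y))"
      using k x y add_coset[of x "- y"] add[of "tensor_coset A R x" "tensor_coset A R (- y)"]
      by (simp add: carrier_tensor)
    moreover have "P (tensor_coset A R (- x + y))"
      using k x y add_coset[of "- x" y] add[of "tensor_coset A R (- x)" "tensor_coset A R y"]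
      by (simp add: carrier_tensor)
    ultimately show "P (tensor_coset A R (x - y)) \<and> P (tensor_coset A R (- (x - y)))"
      by simp
  next
    fix z assume "z \<in> carrier A \<times> carrier R"
    then show "P (tensor_coset A R (frag_of z)) \<and> P (tensor_coset A R (- frag_of z))"
      using pure[of "fst z" "snd z"] pure[of "fst z" "\<ominus>\<^bsub>R\<^esub> snd z"] neg[of "fst z" "snd z"]
      by (auto simp: pure_tensor_def)
  qed
  with u show ?thesis by (auto simp: carrier_tensor)
qed

lemma tensor_universal:
  assumes G: "abelian_group G"
    and closed: "\<And>a r. \<lbrakk>a \<in> carrier A; r \<in> carrier R\<rbrakk> \<Longrightarrow> f a r \<in> carrier G"
    and add_left: "\<And>a a' r. \<lbrakk>a \<in> carrier A; a' \<in> carrier A; r \<in> carrier R\<rbrakk>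
      \<Longrightarrow> f (a \<oplus>\<^bsub>A\<^esub> a') r = f a r \<oplus>\<^bsub>G\<^esub> f a' r"
    and add_right: "\<And>a r r'. \<lbrakk>a \<in> carrier A; r \<in> carrier R; r' \<in> carrier R\<rbrakk>
      \<Longrightarrow> f a (r \<oplus>\<^bsub>R\<^esub> r') = f a r \<oplus>\<^bsub>G\<^esub> f a r'"
  obtains \<phi> where "\<phi> \<in> hom (add_monoid T) (add_monoid G)"
    and "\<And>a r. \<lbrakk>a \<in> carrier A; r \<in> carrier R\<rbrakk> \<Longrightarrow> \<phi> (pure_tensor A R a r) = f a r"
proof -
  interpret G: abelian_group G by fact
  have "case_prod f ` (carrier A \<times> carrier R) \<subseteq> carrier (add_monoid G)"
    using closed by auto
  from comm_group.free_Abelian_group_universal[OF G.a_comm_group this]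
  obtain h where h: "h \<in> hom Fr (add_monoid G)"
    and hf: "\<And>z. z \<in> carrier A \<times> carrier R \<Longrightarrow> h (frag_of z) = case_prod f z"
    by blast
  interpret h: group_hom Fr "add_monoid G" h
    using h by (simp add: group_hom_def group_hom_axioms_def Fr.is_group G.a_group)
  have hdiff: "h (x - y) = h x \<ominus>\<^bsub>G\<^esub> h y" if "x \<in> carrier Fr" "y \<in> carrier Fr" for x y
    using h.hom_mult[of x "- y"] h.hom_inv[of y] that by (simp add: a_minus_def a_inv_def)
  \<comment> \<open>Both kinds of relators have this shape.\<close>
  have d3: "h (frag_of z - frag_of z1 - frag_of z2) = \<zero>\<^bsub>G\<^esub>"
    if "z \<in> carrier A \<times> carrier R" "z1 \<in> carrier A \<times> carrier R" "z2 \<in> carrier A \<times> carrier R"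
      "h (frag_of z) = h (frag_of z1) \<oplus>\<^bsub>G\<^esub> h (frag_of z2)" for z z1 z2
  proof -
    have "frag_of z - frag_of z1 - frag_of z2 = frag_of z - (frag_of z1 + frag_of z2)"
      by (simp add: diff_diff_eq)
    moreover have k: "frag_of z1 + frag_of z2 \<in> carrier Fr"
      using Fr.m_closed[of "frag_of z1" "frag_of z2"] that by simp
    moreover have "h (frag_of z1 + frag_of z2) = h (frag_of z1) \<oplus>\<^bsub>G\<^esub> h (frag_of z2)"
      using h.hom_mult[of "frag_of z1" "frag_of z2"] that by simp
    moreover have "h (frag_of z) \<in> carrier G"
      using h.hom_closed[of "frag_of z"] that by simp
    ultimately show ?thesis
      using hdiff[of "frag_of z" "frag_of z1 + frag_of z2"] that
      by (simp add: a_minus_def G.r_neg diff_diff_eq)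
  qed
  have rel: "h k \<in> {\<zero>\<^bsub>G\<^esub>}" if "k \<in> tensor_relators A R" for k
    using that
    by (cases rule: tensor_relators_cases) (auto intro!: d3 simp: hf add_left add_right)
  have ker: "h k = \<zero>\<^bsub>G\<^esub>" if "k \<in> Kr" for k
    using additive_map_kills_ker[OF G.a_group h rel _ that] group.triv_subgroup[OF G.a_group] by simp
  define \<phi> where "\<phi> u = h (SOME x. x \<in> u)" for u
  have \<phi>: "\<phi> (tensor_coset A R x) = h x" if x: "x \<in> carrier Fr" for x
  proof -
    have "(SOME y. y \<in> tensor_coset A R x) \<in> tensor_coset A R x"
      using coset_self[OF x] by (rule someI)
    then obtain k where k: "k \<in> Kr" "(SOME y. y \<in> tensor_coset A R x) = k + x"
      using coset_mem[OF x] by blast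
    have kF: "k \<in> carrier Fr" using k subgroup.subset[OF ker_subgroup] by blast
    show ?thesis
      using h.hom_mult[OF kF x] ker[OF k(1)] h.hom_closed[OF x] k by (simp add: \<phi>_def)
  qed
  have "\<phi> \<in> hom (add_monoid T) (add_monoid G)"
  proof (rule homI)
    fix u assume "u \<in> carrier (add_monoid T)"
    then show "\<phi> u \<in> carrier (add_monoid G)"
      using h.hom_closed by (auto simp: carrier_tensor \<phi>)
  next
    fix u v assume "u \<in> carrier (add_monoid T)" "v \<in> carrier (add_monoid T)"
    then obtain x y where xy: "x \<in> carrier Fr" "y \<in> carrier Fr"
      "u = tensor_coset A R x" "v = tensor_coset A R y"
      by (auto simp: carrier_tensor simp del: carrier_free_Abelian_group_iff)
    have "\<phi> (tensor_coset A R (x + y)) = h x \<oplus>\<^bsub>G\<^esub> h y"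
      using \<phi>[of "x + y"] Fr.m_closed[OF xy(1,2)] h.hom_mult[OF xy(1,2)] by simp
    then show "\<phi> (u \<otimes>\<^bsub>add_monoid T\<^esub> v) = \<phi> u \<otimes>\<^bsub>add_monoid G\<^esub> \<phi> v"
      using xy by (simp add: add_coset \<phi>)
  qed
  moreover have "\<phi> (pure_tensor A R a r) = f a r" if "a \<in> carrier A" "r \<in> carrier R" for a r
    using \<phi>[of "frag_of (a, r)"] hf[of "(a, r)"] that by (simp add: pure_tensor_def)
  ultimately show thesis using that by blast
qed

end

section \<open>Free modules described by coordinates\<close>

text \<open>
  A finite free module with basis \<open>e\<close> and dual basis \<open>p\<close>. Carrying the coordinate functionals
  along, rather than linear independence, is what makes base change easy: functionals can be
  constructed on the new module by its universal property.
\<close>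

locale coordinate_system = Module.module R M for R (structure) and M (structure) +
  fixes I :: "'i set" and e :: "'i \<Rightarrow> 'c" and p :: "'i \<Rightarrow> 'c \<Rightarrow> 'a"
  assumes finite_index: "finite I"
    and e_closed: "i \<in> I \<Longrightarrow> e i \<in> carrier M"
    and coord_additive: "i \<in> I \<Longrightarrow> p i \<in> hom (add_monoid M) (add_monoid R)"
    and coord_smult: "\<lbrakk>i \<in> I; r \<in> carrier R; x \<in> carrier M\<rbrakk> \<Longrightarrow> p i (r \<odot>\<^bsub>M\<^esub> x) = r \<otimes> p i x"
    and coord_e: "\<lbrakk>i \<in> I; j \<in> I\<rbrakk> \<Longrightarrow> p i (e j) = (if i = j then \<one> else \<zero>)"
    and expand: "x \<in> carrier M \<Longrightarrow> x = (\<Oplus>\<^bsub>M\<^esub>i\<in>I. p i x \<odot>\<^bsub>M\<^esub> e i)"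
begin

lemma coord_closed: "\<lbrakk>i \<in> I; x \<in> carrier M\<rbrakk> \<Longrightarrow> p i x \<in> carrier R"
  using additive_map_closed[OF coord_additive] by simp

lemma coord_eqI:
  assumes "x \<in> carrier M" "y \<in> carrier M" "\<And>i. i \<in> I \<Longrightarrow> p i x = p i y"
  shows "x = y"
proof -
  have "(\<Oplus>\<^bsub>M\<^esub>i\<in>I. p i x \<odot>\<^bsub>M\<^esub> e i) = (\<Oplus>\<^bsub>M\<^esub>i\<in>I. p i y \<odot>\<^bsub>M\<^esub> e i)"
    using assms by (intro finsum_cong') (auto simp: coord_closed e_closed)
  then show ?thesis
    using expand[OF assms(1)] expand[OF assms(2)] by simp
qed

lemma coord_induct [consumes 1, case_names zero e add smult]:
  assumes x: "x \<in> carrier M" and zero: "P \<zero>\<^bsub>M\<^esub>" and e: "\<And>i. i \<in> I \<Longrightarrow> P (e i)"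
    and add: "\<And>x y. \<lbrakk>x \<in> carrier M; y \<in> carrier M; P x; P y\<rbrakk> \<Longrightarrow> P (x \<oplus>\<^bsub>M\<^esub> y)"
    and smult: "\<And>r x. \<lbrakk>r \<in> carrier R; x \<in> carrier M; P x\<rbrakk> \<Longrightarrow> P (r \<odot>\<^bsub>M\<^esub> x)"
  shows "P x"
proof -
  have "P (\<Oplus>\<^bsub>M\<^esub>i\<in>J. p i x \<odot>\<^bsub>M\<^esub> e i)" if "finite J" "J \<subseteq> I" for J
    using that
  proof (induction J rule: finite_induct)
    case (insert i J)
    then have c: "(\<lambda>i. p i x \<odot>\<^bsub>M\<^esub> e i) \<in> J \<rightarrow> carrier M" "p i x \<odot>\<^bsub>M\<^esub> e i \<in> carrier M"
      using x by (auto simp: coord_closed e_closed)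
    have "P (p i x \<odot>\<^bsub>M\<^esub> e i)"
      using insert x by (intro smult e) (simp_all add: coord_closed e_closed)
    then show ?case
      using insert c by (simp add: add)
  qed (simp add: zero)
  from this[OF finite_index subset_refl] expand[OF x] show ?thesis by simp
qed

lemma linear_extension:
  assumes N: "Module.module R N" and v: "\<And>i. i \<in> I \<Longrightarrow> v i \<in> carrier N"
  obtains L where "L \<in> module_hom R M N" and "\<And>i. i \<in> I \<Longrightarrow> L (e i) = v i"
proof -
  interpret N: Module.module R N by fact
  define L where "L x = (\<Oplus>\<^bsub>N\<^esub>i\<in>I. p i x \<odot>\<^bsub>N\<^esub> v i)" for x
  have c: "(\<lambda>i. p i x \<odot>\<^bsub>N\<^esub> v i) \<in> I \<rightarrow> carrier N" if "x \<in> carrier M" for x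
    using that v by (auto simp: coord_closed)
  have "L \<in> module_hom R M N"
    unfolding module_hom_def
  proof (intro CollectI conjI allI impI)
    show "L \<in> carrier M \<rightarrow> carrier N"
      using c by (auto simp: L_def)
  next
    fix x y assume xy: "x \<in> carrier M \<and> y \<in> carrier M"
    have "L (x \<oplus>\<^bsub>M\<^esub> y) = (\<Oplus>\<^bsub>N\<^esub>i\<in>I. p i x \<odot>\<^bsub>N\<^esub> v i \<oplus>\<^bsub>N\<^esub> p i y \<odot>\<^bsub>N\<^esub> v i)"
      unfolding L_def using xy v
      by (intro N.finsum_cong')
        (auto simp: additive_map_add[OF coord_additive] N.smult_l_distr coord_closed)
    also have "\<dots> = L x \<oplus>\<^bsub>N\<^esub> L y"
      unfolding L_def using xy c by (intro N.finsum_addf) auto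
    finally show "L (x \<oplus>\<^bsub>M\<^esub> y) = L x \<oplus>\<^bsub>N\<^esub> L y" .
  next
    fix r x assume rx: "r \<in> carrier R \<and> x \<in> carrier M"
    have "L (r \<odot>\<^bsub>M\<^esub> x) = (\<Oplus>\<^bsub>N\<^esub>i\<in>I. r \<odot>\<^bsub>N\<^esub> (p i x \<odot>\<^bsub>N\<^esub> v i))"
      unfolding L_def using rx v
      by (intro N.finsum_cong') (auto simp: coord_smult N.smult_assoc1 coord_closed)
    also have "\<dots> = r \<odot>\<^bsub>N\<^esub> L x"
      unfolding L_def using rx c by (intro N.finsum_smult[symmetric]) auto
    finally show "L (r \<odot>\<^bsub>M\<^esub> x) = r \<odot>\<^bsub>N\<^esub> L x" .
  qed
  moreover have "L (e j) = v j" if j: "j \<in> I" for j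
  proof -
    have "L (e j) = (\<Oplus>\<^bsub>N\<^esub>i\<in>I. if j = i then v i else \<zero>\<^bsub>N\<^esub>)"
      unfolding L_def using j v by (intro N.finsum_cong') (auto simp: coord_e N.lmult_0)
    also have "\<dots> = v j"
      using j v finite_index by (intro N.add.finprod_singleton) auto
    finally show ?thesis .
  qed
  ultimately show thesis using that by blast
qed

lemma coord_exists:
  assumes "\<And>i. i \<in> I \<Longrightarrow> c i \<in> carrier R"
  obtains x where "x \<in> carrier M" and "\<And>i. i \<in> I \<Longrightarrow> p i x = c i"
proof
  let ?x = "\<Oplus>\<^bsub>M\<^esub>i\<in>I. c i \<odot>\<^bsub>M\<^esub> e i"
  have c: "(\<lambda>i. c i \<odot>\<^bsub>M\<^esub> e i) \<in> I \<rightarrow> carrier M"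
    using assms by (auto simp: e_closed)
  then show "?x \<in> carrier M" by simp
  fix j assume j: "j \<in> I"
  have "p j ?x = (\<Oplus>i\<in>I. p j (c i \<odot>\<^bsub>M\<^esub> e i))"
    using additive_map_finsum[OF M.abelian_group_axioms R.abelian_group_axioms coord_additive[OF j] c] .
  also have "\<dots> = (\<Oplus>i\<in>I. if j = i then c i else \<zero>)"
    using j assms by (intro R.finsum_cong') (auto simp: coord_smult coord_e e_closed)
  also have "\<dots> = c j"
    using j assms finite_index by (intro R.add.finprod_singleton) auto
  finally show "p j ?x = c j" .
qed

lemma module_hom_eq:
  assumes L: "L \<in> module_hom R M N" and L': "L' \<in> module_hom R M N"
    and N: "Module.module R N"
    and e: "\<And>i. i \<in> I \<Longrightarrow> L (e i) = L' (e i)" and x: "x \<in> carrier M"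
  shows "L x = L' x"
  using x
proof (induction rule: coord_induct)
  case zero
  interpret N: Module.module R N by fact
  have "L \<zero>\<^bsub>M\<^esub> = \<zero>\<^bsub>N\<^esub>" if "L \<in> module_hom R M N" for L
  proof -
    have "L (\<zero> \<odot>\<^bsub>M\<^esub> \<zero>\<^bsub>M\<^esub>) = \<zero> \<odot>\<^bsub>N\<^esub> L \<zero>\<^bsub>M\<^esub>"
      by (rule module_hom_smult[OF that R.zero_closed M.zero_closed])
    also have "\<dots> = \<zero>\<^bsub>N\<^esub>"
      by (rule N.lmult_0) (use module_hom_closed[OF that] in auto)
    finally show ?thesis by (simp add: lmult_0)
  qed
  from this[OF L] this[OF L'] show ?case by simp
qed (simp_all add: e module_hom_add[OF L] module_hom_add[OF L'] module_hom_smult[OF L] module_hom_smult[OF L'])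

end

lemma (in vectorspace) finite_basis_coordinates:
  assumes fin: "finite B" and B: "basis B"
  obtains p where "coordinate_system K V B (\<lambda>b. b) p"
proof -
  have BV: "B \<subseteq> carrier V" using B by (simp add: basis_def)
  define c where "c v = (THE a. a \<in> B \<rightarrow>\<^sub>E carrier K \<and> lincomb a B = v)" for v
  have ex: "\<exists>!a. a \<in> B \<rightarrow>\<^sub>E carrier K \<and> lincomb a B = v" if "v \<in> carrier V" for v
    using B that basis_criterion[OF fin BV] by blast
  have c: "c v \<in> B \<rightarrow>\<^sub>E carrier K" "lincomb (c v) B = v" if "v \<in> carrier V" for v
    using theI'[OF ex[OF that]] unfolding c_def by simp_all
  have cB: "c v \<in> B \<rightarrow> carrier K" if "v \<in> carrier V" for v
    using c(1)[OF that] by auto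
  have uniq: "c v b = a b" if "a \<in> B \<rightarrow> carrier K" "lincomb a B = v" "b \<in> B" for a v b
  proof -
    have v: "v \<in> carrier V" using that BV lincomb_closed by blast
    have "lincomb (restrict a B) B = v"
      using that BV by (subst lincomb_cong[of B B "restrict a B" a]) auto
    moreover have "restrict a B \<in> B \<rightarrow>\<^sub>E carrier K" using that by auto
    ultimately have "c v = restrict a B"
      using ex[OF v] c[OF v] by blast
    then show ?thesis using that by simp
  qed
  have "coordinate_system K V B (\<lambda>b. b) (\<lambda>b v. c v b)"
  proof (unfold_locales)
    fix b assume b: "b \<in> B"
    show "b \<in> carrier V" using b BV by blast
    show "(\<lambda>v. c v b) \<in> hom (add_monoid V) (add_monoid K)"
    proof (rule homI)
      fix v w assume "v \<in> carrier (add_monoid V)" "w \<in> carrier (add_monoid V)"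
      then have vw: "v \<in> carrier V" "w \<in> carrier V" by simp_all
      have "c (v \<oplus>\<^bsub>V\<^esub> w) b = c v b \<oplus>\<^bsub>K\<^esub> c w b"
        using cB[OF vw(1)] cB[OF vw(2)] c(2)[OF vw(1)] c(2)[OF vw(2)] b
        by (intro uniq[of "\<lambda>b. c v b \<oplus>\<^bsub>K\<^esub> c w b"]) (auto simp: lincomb_sum[OF fin BV])
      then show "c (v \<otimes>\<^bsub>add_monoid V\<^esub> w) b = c v b \<otimes>\<^bsub>add_monoid K\<^esub> c w b" by simp
    qed (use cB b in auto)
  next
    fix b r v assume brv: "b \<in> B" "r \<in> carrier K" "v \<in> carrier V"
    show "c (r \<odot>\<^bsub>V\<^esub> v) b = r \<otimes>\<^bsub>K\<^esub> c v b"
      using cB[OF brv(3)] c(2)[OF brv(3)] brv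
      by (intro uniq[of "\<lambda>b. r \<otimes>\<^bsub>K\<^esub> c v b"]) (auto simp: lincomb_smult[OF BV])
  next
    fix b b' assume bb: "b \<in> B" "b' \<in> B"
    have "lincomb (\<lambda>b. if b = b' then \<one>\<^bsub>K\<^esub> else \<zero>\<^bsub>K\<^esub>) B = (\<Oplus>\<^bsub>V\<^esub>b\<in>B. if b' = b then b else \<zero>\<^bsub>V\<^esub>)"
      unfolding lincomb_def using BV by (intro M.finsum_cong') (auto simp: lmult_0)
    also have "\<dots> = b'"
      using bb fin BV by (intro M.add.finprod_singleton) auto
    finally show "c b' b = (if b = b' then \<one>\<^bsub>K\<^esub> else \<zero>\<^bsub>K\<^esub>)"
      using bb by (intro uniq) auto
  next
    fix v assume v: "v \<in> carrier V"
    then show "v = (\<Oplus>\<^bsub>V\<^esub>b\<in>B. c v b \<odot>\<^bsub>V\<^esub> b)"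
      using c(2)[OF v] by (simp add: lincomb_def)
  qed (rule fin)
  then show thesis by (rule that)
qed

lemma coordinate_system_cong:
  assumes "coordinate_system R M I e p" and "\<And>i. i \<in> I \<Longrightarrow> e' i = e i"
  shows "coordinate_system R M I e' p"
proof -
  interpret coordinate_system R M I e p by fact
  show ?thesis
  proof unfold_locales
    fix x assume x: "x \<in> carrier M"
    have "(\<Oplus>\<^bsub>M\<^esub>i\<in>I. p i x \<odot>\<^bsub>M\<^esub> e' i) = (\<Oplus>\<^bsub>M\<^esub>i\<in>I. p i x \<odot>\<^bsub>M\<^esub> e i)"
      using x assms(2) by (intro finsum_cong') (auto simp: coord_closed e_closed)
    then show "x = (\<Oplus>\<^bsub>M\<^esub>i\<in>I. p i x \<odot>\<^bsub>M\<^esub> e' i)"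
      using expand[OF x] by simp
  next
    show "p i \<in> hom (add_monoid M) (add_monoid R)" if "i \<in> I" for i
      by (rule coord_additive[OF that])
  qed (simp_all add: finite_index e_closed coord_smult coord_e assms(2))
qed

section \<open>Algebra homomorphisms\<close>

lemma (in nonassoc_algebra) zero_mult: "y \<in> carrier A \<Longrightarrow> \<zero>\<^bsub>A\<^esub> \<otimes>\<^bsub>A\<^esub> y = \<zero>\<^bsub>A\<^esub>"
  using mult_smult_l[of \<zero> "\<zero>\<^bsub>A\<^esub>" y] mult_closed[of "\<zero>\<^bsub>A\<^esub>" y] by (simp add: lmult_0)

lemma (in nonassoc_algebra) mult_zero: "y \<in> carrier A \<Longrightarrow> y \<otimes>\<^bsub>A\<^esub> \<zero>\<^bsub>A\<^esub> = \<zero>\<^bsub>A\<^esub>"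
  using mult_smult_r[of \<zero> y "\<zero>\<^bsub>A\<^esub>"] mult_closed[of y "\<zero>\<^bsub>A\<^esub>"] by (simp add: lmult_0)

lemma module_hom_zero:
  assumes "Module.module R M" "Module.module R N" "L \<in> module_hom R M N"
  shows "L \<zero>\<^bsub>M\<^esub> = \<zero>\<^bsub>N\<^esub>"
  using assms module_hom_closed[OF assms(3)] module_hom_add[OF assms(3)]
  by (intro additive_map_zero) (auto simp: Module.module_def intro!: homI)

text \<open>
  Both products are bilinear.
\<close>

lemma multiplicative_on_basis:
  assumes M: "nonassoc_algebra R M" and N: "nonassoc_algebra R N"
    and L: "L \<in> module_hom R M N" and c: "coordinate_system R M I e p"
    and basis: "\<And>i j. \<lbrakk>i \<in> I; j \<in> I\<rbrakk> \<Longrightarrow> L (e i \<otimes>\<^bsub>M\<^esub> e j) = L (e i) \<otimes>\<^bsub>N\<^esub> L (e j)"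
  shows "L \<in> hom M N"
proof -
  interpret M: nonassoc_algebra R M by fact
  interpret N: nonassoc_algebra R N by fact
  interpret c: coordinate_system R M I e p by fact
  have Lc: "L x \<in> carrier N" if "x \<in> carrier M" for x
    using module_hom_closed[OF L] that by auto
  note L_simps = module_hom_add[OF L] module_hom_smult[OF L]
    module_hom_zero[OF M.module_axioms N.module_axioms L]
  have 1: "L (e i \<otimes>\<^bsub>M\<^esub> y) = L (e i) \<otimes>\<^bsub>N\<^esub> L y" if i: "i \<in> I" and y: "y \<in> carrier M" for i y
    using y
  proof (induction rule: c.coord_induct)
    case zero
    then show ?case using i by (simp add: L_simps M.mult_zero N.mult_zero Lc c.e_closed)
  next
    case (add x y)
    then show ?case using i by (simp add: L_simps M.mult_r_distr N.mult_r_distr M.mult_closed Lc c.e_closed)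
  next
    case (smult r x)
    then show ?case using i by (simp add: L_simps M.mult_smult_r N.mult_smult_r M.mult_closed Lc c.e_closed)
  qed (rule basis[OF i])
  have "L (x \<otimes>\<^bsub>M\<^esub> y) = L x \<otimes>\<^bsub>N\<^esub> L y" if x: "x \<in> carrier M" and y: "y \<in> carrier M" for x y
    using x
  proof (induction rule: c.coord_induct)
    case zero
    then show ?case using y by (simp add: L_simps M.zero_mult N.zero_mult Lc)
  next
    case (add x x')
    then show ?case using y by (simp add: L_simps M.mult_l_distr N.mult_l_distr M.mult_closed Lc)
  next
    case (smult r x)
    then show ?case using y by (simp add: L_simps M.mult_smult_l N.mult_smult_l M.mult_closed Lc)
  qed (rule 1[OF _ y])
  then show ?thesis using Lc by (intro homI)
qed

lemma alg_iso_inverse: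
  assumes A: "nonassoc_algebra R A" and h: "h \<in> alg_iso R A B"
  shows "inv_into (carrier A) h \<in> alg_iso R B A"
proof -
  interpret A: nonassoc_algebra R A by fact
  have bij: "bij_betw h (carrier A) (carrier B)" and hm: "h \<in> module_hom R A B" and hh: "h \<in> hom A B"
    using h by (simp_all add: alg_iso_def)
  let ?g = "inv_into (carrier A) h"
  have g: "?g y \<in> carrier A" "h (?g y) = y" if "y \<in> carrier B" for y
    using bij_betwE[OF bij_betw_inv_into[OF bij]] bij_betw_inv_into_right[OF bij] that by auto
  have gh: "?g y = x" if "x \<in> carrier A" "h x = y" for x y
    using bij_betw_inv_into_left[OF bij that(1)] that(2) by simp
  have "?g \<in> module_hom R B A"
    unfolding module_hom_def
    by (auto intro!: gh simp: g module_hom_add[OF hm] module_hom_smult[OF hm])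
  moreover have "?g \<in> hom B A"
    by (rule homI) (auto intro!: gh simp: g hom_mult[OF hh] A.mult_closed)
  ultimately show ?thesis
    using bij_betw_inv_into[OF bij] by (simp add: alg_iso_def)
qed

section \<open>The module structure of an extension invariant functor\<close>

lemma rng_hom_additive: "\<alpha> \<in> rng_hom S T \<Longrightarrow> \<alpha> \<in> hom (add_monoid S) (add_monoid T)"
  by (simp add: rng_hom_def ring_hom_def hom_def)

text \<open>
  The isomorphism of \<open>F(S)\<close> with \<open>F(\<int>) \<otimes> S\<close> serves to transport induction over pure tensors and the
  universal property of the tensor product; afterwards all arguments take place in \<open>F(S)\<close>, where
  \<open>gen S a s\<close> stands for \<open>a \<otimes> s\<close>.
\<close>

locale invariant_functor = extension_invariant Z F
  for Z :: "'u ring" and F :: "('u, 'b) functor_data" +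
  assumes Z_obj: "Z \<in> rng_obj"
begin

lemma algebra: "S \<in> rng_obj \<Longrightarrow> nonassoc_algebra S (Ob F S)"
  by (rule Ob_algebra)

lemma module: "S \<in> rng_obj \<Longrightarrow> Module.module S (Ob F S)"
  by (rule nonassoc_algebra.axioms(1)[OF algebra])

lemma abelian: "S \<in> rng_obj \<Longrightarrow> abelian_group (Ob F S)"
  using module[of S] by (simp add: Module.module_def)

lemma cring: "S \<in> rng_obj \<Longrightarrow> cring S"
  by (simp add: rng_obj_def)

lemma tensor: "S \<in> rng_obj \<Longrightarrow> tensor_product (Ob F Z) S"
  using abelian[OF Z_obj] cring by (simp add: tensor_product_def)

lemma Mor_additive:
  "\<lbrakk>S \<in> rng_obj; T \<in> rng_obj; \<alpha> \<in> rng_hom S T\<rbrakk>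
    \<Longrightarrow> Mor F S T \<alpha> \<in> hom (add_monoid (Ob F S)) (add_monoid (Ob F T))"
  using Mor_hom[of S T \<alpha>] by (simp add: Zalg_hom_def)

lemma Mor_closed:
  "\<lbrakk>S \<in> rng_obj; T \<in> rng_obj; \<alpha> \<in> rng_hom S T; x \<in> carrier (Ob F S)\<rbrakk>
    \<Longrightarrow> Mor F S T \<alpha> x \<in> carrier (Ob F T)"
  by (rule additive_map_closed[OF Mor_additive])

lemma Mor_add:
  "\<lbrakk>S \<in> rng_obj; T \<in> rng_obj; \<alpha> \<in> rng_hom S T; x \<in> carrier (Ob F S); y \<in> carrier (Ob F S)\<rbrakk>
    \<Longrightarrow> Mor F S T \<alpha> (x \<oplus>\<^bsub>Ob F S\<^esub> y) = Mor F S T \<alpha> x \<oplus>\<^bsub>Ob F T\<^esub> Mor F S T \<alpha> y"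
  by (rule additive_map_add[OF Mor_additive])

lemma Mor_mult:
  "\<lbrakk>S \<in> rng_obj; T \<in> rng_obj; \<alpha> \<in> rng_hom S T; x \<in> carrier (Ob F S); y \<in> carrier (Ob F S)\<rbrakk>
    \<Longrightarrow> Mor F S T \<alpha> (x \<otimes>\<^bsub>Ob F S\<^esub> y) = Mor F S T \<alpha> x \<otimes>\<^bsub>Ob F T\<^esub> Mor F S T \<alpha> y"
  using Mor_hom[of S T \<alpha>] by (simp add: Zalg_hom_def hom_def)

definition \<tau> where
  "\<tau> = (SOME \<tau>. (\<forall>R\<in>rng_obj. \<tau> R \<in> alg_iso R (Ob F R) (tensor_algebra (Ob F Z) R)) \<and>
         (\<forall>R\<in>rng_obj. \<forall>S\<in>rng_obj. \<forall>\<alpha>\<in>rng_hom R S. \<forall>x\<in>carrier (Ob F R).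
            tensor_map (Ob F Z) S \<alpha> (\<tau> R x) = \<tau> S (Mor F R S \<alpha> x)))"

lemma
  shows tau_iso: "S \<in> rng_obj \<Longrightarrow> \<tau> S \<in> alg_iso S (Ob F S) (tensor_algebra (Ob F Z) S)"
    and tau_natural: "\<lbrakk>S \<in> rng_obj; S' \<in> rng_obj; \<alpha> \<in> rng_hom S S'; x \<in> carrier (Ob F S)\<rbrakk>
      \<Longrightarrow> tensor_map (Ob F Z) S' \<alpha> (\<tau> S x) = \<tau> S' (Mor F S S' \<alpha> x)"
proof -
  have *: "(\<forall>R\<in>rng_obj. \<tau> R \<in> alg_iso R (Ob F R) (tensor_algebra (Ob F Z) R)) \<and>
         (\<forall>R\<in>rng_obj. \<forall>S\<in>rng_obj. \<forall>\<alpha>\<in>rng_hom R S. \<forall>x\<in>carrier (Ob F R).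
            tensor_map (Ob F Z) S \<alpha> (\<tau> R x) = \<tau> S (Mor F R S \<alpha> x))"
    unfolding \<tau>_def by (rule someI_ex[OF invariant])
  then show "S \<in> rng_obj \<Longrightarrow> \<tau> S \<in> alg_iso S (Ob F S) (tensor_algebra (Ob F Z) S)"
    by simp
  from * show "\<lbrakk>S \<in> rng_obj; S' \<in> rng_obj; \<alpha> \<in> rng_hom S S'; x \<in> carrier (Ob F S)\<rbrakk>
      \<Longrightarrow> tensor_map (Ob F Z) S' \<alpha> (\<tau> S x) = \<tau> S' (Mor F S S' \<alpha> x)"
    by simp
qed

lemma tau_bij: "S \<in> rng_obj \<Longrightarrow> bij_betw (\<tau> S) (carrier (Ob F S)) (carrier (tensor_algebra (Ob F Z) S))"
  using tau_iso by (simp add: alg_iso_def)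

lemma tau_inj: "\<lbrakk>S \<in> rng_obj; x \<in> carrier (Ob F S); y \<in> carrier (Ob F S); \<tau> S x = \<tau> S y\<rbrakk> \<Longrightarrow> x = y"
  by (rule inj_onD[OF bij_betw_imp_inj_on[OF tau_bij]])

lemma tau_closed: "\<lbrakk>S \<in> rng_obj; x \<in> carrier (Ob F S)\<rbrakk> \<Longrightarrow> \<tau> S x \<in> carrier (tensor_algebra (Ob F Z) S)"
  using bij_betwE[OF tau_bij] by blast

lemma tau_add:
  "\<lbrakk>S \<in> rng_obj; x \<in> carrier (Ob F S); y \<in> carrier (Ob F S)\<rbrakk>
    \<Longrightarrow> \<tau> S (x \<oplus>\<^bsub>Ob F S\<^esub> y) = \<tau> S x \<oplus>\<^bsub>tensor_algebra (Ob F Z) S\<^esub> \<tau> S y"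
  using tau_iso by (simp add: alg_iso_def module_hom_def)

lemma tau_smult:
  "\<lbrakk>S \<in> rng_obj; s \<in> carrier S; x \<in> carrier (Ob F S)\<rbrakk>
    \<Longrightarrow> \<tau> S (s \<odot>\<^bsub>Ob F S\<^esub> x) = s \<odot>\<^bsub>tensor_algebra (Ob F Z) S\<^esub> \<tau> S x"
  using tau_iso by (simp add: alg_iso_def module_hom_def)

definition gen :: "'u ring \<Rightarrow> 'b \<Rightarrow> 'u \<Rightarrow> 'b" where
  "gen S a s = inv_into (carrier (Ob F S)) (\<tau> S) (pure_tensor (Ob F Z) S a s)"

lemma
  assumes "S \<in> rng_obj" "a \<in> carrier (Ob F Z)" "s \<in> carrier S"
  shows gen_closed: "gen S a s \<in> carrier (Ob F S)"
    and tau_gen: "\<tau> S (gen S a s) = pure_tensor (Ob F Z) S a s"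
proof -
  have "pure_tensor (Ob F Z) S a s \<in> \<tau> S ` carrier (Ob F S)"
    using tensor_product.pure_closed[OF tensor assms(2,3)] tau_bij assms(1)
    by (simp add: bij_betw_def)
  note im = this
  show "gen S a s \<in> carrier (Ob F S)"
    unfolding gen_def by (rule inv_into_into[OF im])
  show "\<tau> S (gen S a s) = pure_tensor (Ob F Z) S a s"
    unfolding gen_def by (rule f_inv_into_f[OF im])
qed

lemma add_closed:
  "\<lbrakk>S \<in> rng_obj; x \<in> carrier (Ob F S); y \<in> carrier (Ob F S)\<rbrakk> \<Longrightarrow> x \<oplus>\<^bsub>Ob F S\<^esub> y \<in> carrier (Ob F S)"
  by (rule abelian_groupE(1)[OF abelian])

lemma smult_closed:
  "\<lbrakk>S \<in> rng_obj; s \<in> carrier S; x \<in> carrier (Ob F S)\<rbrakk> \<Longrightarrow> s \<odot>\<^bsub>Ob F S\<^esub> x \<in> carrier (Ob F S)"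
  by (rule module.smult_closed[OF module])

lemma gen_add_left:
  assumes "S \<in> rng_obj" "a \<in> carrier (Ob F Z)" "a' \<in> carrier (Ob F Z)" "s \<in> carrier S"
  shows "gen S (a \<oplus>\<^bsub>Ob F Z\<^esub> a') s = gen S a s \<oplus>\<^bsub>Ob F S\<^esub> gen S a' s"
  using assms add_closed[OF Z_obj]
  by (intro tau_inj[of S])
    (simp_all add: add_closed gen_closed tau_gen tau_add tensor_product.pure_add_left[OF tensor])

lemma gen_add_right:
  assumes "S \<in> rng_obj" "a \<in> carrier (Ob F Z)" "s \<in> carrier S" "s' \<in> carrier S"
  shows "gen S a (s \<oplus>\<^bsub>S\<^esub> s') = gen S a s \<oplus>\<^bsub>Ob F S\<^esub> gen S a s'"
proof -
  interpret S: cring S using cring[OF assms(1)] .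
  show ?thesis
    using assms
    by (intro tau_inj[of S])
      (simp_all add: add_closed gen_closed tau_gen tau_add tensor_product.pure_add_right[OF tensor])
qed

lemma smult_gen:
  assumes "S \<in> rng_obj" "s \<in> carrier S" "a \<in> carrier (Ob F Z)" "r \<in> carrier S"
  shows "s \<odot>\<^bsub>Ob F S\<^esub> gen S a r = gen S a (s \<otimes>\<^bsub>S\<^esub> r)"
proof -
  interpret S: cring S using cring[OF assms(1)] .
  show ?thesis
    using assms
    by (intro tau_inj[of S])
      (simp_all add: smult_closed gen_closed tau_gen tau_smult tensor_product.smult_pure[OF tensor])
qed

lemma Mor_gen:
  assumes "S \<in> rng_obj" "T \<in> rng_obj" "\<alpha> \<in> rng_hom S T" "a \<in> carrier (Ob F Z)" "s \<in> carrier S"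
  shows "Mor F S T \<alpha> (gen S a s) = gen T a (\<alpha> s)"
proof -
  have "\<alpha> s \<in> carrier T"
    using additive_map_closed[OF rng_hom_additive, of \<alpha> S T s] assms by simp
  then show ?thesis
    using assms tau_natural[of S T \<alpha> "gen S a s"]
      tensor_product.tensor_map_pure[OF tensor cring rng_hom_additive, of S T \<alpha> a s]
    by (intro tau_inj[of T]) (simp_all add: gen_closed Mor_closed tau_gen)
qed

lemma gen_induct [consumes 2, case_names gen add]:
  assumes S: "S \<in> rng_obj" and x: "x \<in> carrier (Ob F S)"
    and gen: "\<And>a s. \<lbrakk>a \<in> carrier (Ob F Z); s \<in> carrier S\<rbrakk> \<Longrightarrow> P (gen S a s)"
    and add: "\<And>x y. \<lbrakk>x \<in> carrier (Ob F S); y \<in> carrier (Ob F S); P x; P y\<rbrakk> \<Longrightarrow> P (x \<oplus>\<^bsub>Ob F S\<^esub> y)"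
  shows "P x"
proof -
  have "\<exists>x\<in>carrier (Ob F S). u = \<tau> S x \<and> P x" if "u \<in> carrier (tensor_algebra (Ob F Z) S)" for u
    using that
  proof (rule tensor_product.tensor_induct[OF tensor[OF S]])
    fix a s assume "a \<in> carrier (Ob F Z)" "s \<in> carrier S"
    then show "\<exists>x\<in>carrier (Ob F S). pure_tensor (Ob F Z) S a s = \<tau> S x \<and> P x"
      using gen S by (intro bexI[of _ "gen S a s"]) (simp_all add: gen_closed tau_gen)
  next
    fix u v
    assume "\<exists>x\<in>carrier (Ob F S). u = \<tau> S x \<and> P x" "\<exists>y\<in>carrier (Ob F S). v = \<tau> S y \<and> P y"
    then obtain x y where "x \<in> carrier (Ob F S)" "u = \<tau> S x" "P x" "y \<in> carrier (Ob F S)" "v = \<tau> S y" "P y"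
      by blast
    then show "\<exists>x\<in>carrier (Ob F S). u \<oplus>\<^bsub>tensor_algebra (Ob F Z) S\<^esub> v = \<tau> S x \<and> P x"
      using add[of x y] S by (intro bexI[of _ "x \<oplus>\<^bsub>Ob F S\<^esub> y"]) (simp_all add: add_closed tau_add)
  qed
  from this[OF tau_closed[OF S x]] obtain y where "y \<in> carrier (Ob F S)" "\<tau> S x = \<tau> S y" "P y"
    by blast
  with tau_inj[OF S x] show ?thesis by blast
qed

lemma gen_universal:
  assumes S: "S \<in> rng_obj" and G: "abelian_group G"
    and closed: "\<And>a r. \<lbrakk>a \<in> carrier (Ob F Z); r \<in> carrier S\<rbrakk> \<Longrightarrow> f a r \<in> carrier G"
    and add_left: "\<And>a a' r. \<lbrakk>a \<in> carrier (Ob F Z); a' \<in> carrier (Ob F Z); r \<in> carrier S\<rbrakk>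
      \<Longrightarrow> f (a \<oplus>\<^bsub>Ob F Z\<^esub> a') r = f a r \<oplus>\<^bsub>G\<^esub> f a' r"
    and add_right: "\<And>a r r'. \<lbrakk>a \<in> carrier (Ob F Z); r \<in> carrier S; r' \<in> carrier S\<rbrakk>
      \<Longrightarrow> f a (r \<oplus>\<^bsub>S\<^esub> r') = f a r \<oplus>\<^bsub>G\<^esub> f a r'"
  obtains \<phi> where "\<phi> \<in> hom (add_monoid (Ob F S)) (add_monoid G)"
    and "\<And>a r. \<lbrakk>a \<in> carrier (Ob F Z); r \<in> carrier S\<rbrakk> \<Longrightarrow> \<phi> (gen S a r) = f a r"
proof -
  from tensor_product.tensor_universal[OF tensor[OF S] G closed add_left add_right]
  obtain \<phi> where \<phi>: "\<phi> \<in> hom (add_monoid (tensor_algebra (Ob F Z) S)) (add_monoid G)"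
    and eq: "\<And>a r. \<lbrakk>a \<in> carrier (Ob F Z); r \<in> carrier S\<rbrakk> \<Longrightarrow> \<phi> (pure_tensor (Ob F Z) S a r) = f a r"
    by blast
  have "\<phi> \<circ> \<tau> S \<in> hom (add_monoid (Ob F S)) (add_monoid G)"
    using additive_map_closed[OF \<phi>] additive_map_add[OF \<phi>] tau_closed[OF S] tau_add[OF S]
    by (intro homI) simp_all
  moreover have "(\<phi> \<circ> \<tau> S) (gen S a r) = f a r" if "a \<in> carrier (Ob F Z)" "r \<in> carrier S" for a r
    using eq[OF that] tau_gen[OF S that] by simp
  ultimately show thesis using that by blast
qed

text \<open>
  Semilinearity can be checked on generators, where it reads
  \<open>a \<otimes> \<alpha>(s r) = a \<otimes> \<alpha>(s) \<alpha>(r)\<close>.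
\<close>

lemma Mor_smult:
  assumes S: "S \<in> rng_obj" and T: "T \<in> rng_obj" and \<alpha>: "\<alpha> \<in> rng_hom S T"
    and s: "s \<in> carrier S" and x: "x \<in> carrier (Ob F S)"
  shows "Mor F S T \<alpha> (s \<odot>\<^bsub>Ob F S\<^esub> x) = \<alpha> s \<odot>\<^bsub>Ob F T\<^esub> Mor F S T \<alpha> x"
proof -
  interpret S: cring S using cring S .
  interpret MS: Module.module S "Ob F S" using module S .
  interpret MT: Module.module T "Ob F T" using module T .
  have \<alpha>': "\<alpha> r \<in> carrier T" "\<alpha> (s \<otimes>\<^bsub>S\<^esub> r) = \<alpha> s \<otimes>\<^bsub>T\<^esub> \<alpha> r" if "r \<in> carrier S" for r
    using \<alpha> s that by (auto simp: rng_hom_def ring_hom_def)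
  show ?thesis
    using S x
  proof (induction rule: gen_induct)
    case (gen a r)
    then show ?case
      using S T \<alpha> s \<alpha>' by (simp add: smult_gen Mor_gen)
  next
    case (add x y)
    then show ?case
      using S T \<alpha> s \<alpha>'(1) by (simp add: MS.smult_r_distr MT.smult_r_distr Mor_add Mor_closed)
  qed
qed

end

section \<open>Base change of coordinates\<close>

lemma subring_inclusion_rng_hom:
  assumes "subring B S"
  shows "(\<lambda>r\<in>B. r) \<in> rng_hom (S\<lparr>carrier := B\<rparr>) S"
proof -
  have "(\<lambda>r\<in>B. r) \<in> ring_hom (S\<lparr>carrier := B\<rparr>) S"
    using subringE[OF assms] by (intro ring_hom_memI) auto
  then show ?thesis by (simp add: rng_hom_def)
qed

context invariant_functor
begin

text \<open>
  The image of a basis generates \<open>F(S)\<close> because \<open>gen S a s\<close> is \<open>s\<close> times the image of \<open>gen Q a 1\<close>.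
  The coordinate functionals extend to \<open>F(S)\<close> by the universal property, through
  \<open>a \<otimes> s \<mapsto> \<alpha>(p\<^sub>i(a \<otimes> 1)) s\<close>.
\<close>

lemma coordinates_base_change:
  assumes Q: "Q \<in> rng_obj" and S: "S \<in> rng_obj" and \<alpha>: "\<alpha> \<in> rng_hom Q S"
    and p: "coordinate_system Q (Ob F Q) I e p"
  obtains p' where "coordinate_system S (Ob F S) I (\<lambda>i. Mor F Q S \<alpha> (e i)) p'"
proof -
  interpret Q: coordinate_system Q "Ob F Q" I e p by fact
  interpret MS: Module.module S "Ob F S" by (rule module[OF S])
  have \<alpha>_closed: "\<alpha> q \<in> carrier S" if "q \<in> carrier Q" for q
    using \<alpha> that by (auto simp: rng_hom_def ring_hom_def)
  have \<alpha>_add: "\<alpha> (q \<oplus>\<^bsub>Q\<^esub> r) = \<alpha> q \<oplus>\<^bsub>S\<^esub> \<alpha> r" and \<alpha>_mult: "\<alpha> (q \<otimes>\<^bsub>Q\<^esub> r) = \<alpha> q \<otimes>\<^bsub>S\<^esub> \<alpha> r"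
    if "q \<in> carrier Q" "r \<in> carrier Q" for q r
    using \<alpha> that by (auto simp: rng_hom_def ring_hom_def)
  have \<alpha>_one: "\<alpha> \<one>\<^bsub>Q\<^esub> = \<one>\<^bsub>S\<^esub>"
    using \<alpha> by (auto simp: rng_hom_def ring_hom_def)
  have \<alpha>_zero: "\<alpha> \<zero>\<^bsub>Q\<^esub> = \<zero>\<^bsub>S\<^esub>"
    by (rule additive_map_zero[OF Q.R.abelian_group_axioms MS.R.abelian_group_axioms rng_hom_additive[OF \<alpha>]])
  define c where "c i a = \<alpha> (p i (gen Q a \<one>\<^bsub>Q\<^esub>))" for i a
  have gc: "gen Q a \<one>\<^bsub>Q\<^esub> \<in> carrier (Ob F Q)" if "a \<in> carrier (Ob F Z)" for a
    using gen_closed[OF Q that] by simp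
  have c: "c i a \<in> carrier S" if "i \<in> I" "a \<in> carrier (Ob F Z)" for i a
    using Q.coord_closed[OF that(1) gc[OF that(2)]] by (simp add: c_def \<alpha>_closed)
  have "\<exists>\<phi>. \<phi> \<in> hom (add_monoid (Ob F S)) (add_monoid S) \<and>
      (\<forall>a\<in>carrier (Ob F Z). \<forall>s\<in>carrier S. \<phi> (gen S a s) = c i a \<otimes>\<^bsub>S\<^esub> s)" if i: "i \<in> I" for i
  proof -
    obtain \<phi> where "\<phi> \<in> hom (add_monoid (Ob F S)) (add_monoid S)"
      "\<And>a s. \<lbrakk>a \<in> carrier (Ob F Z); s \<in> carrier S\<rbrakk> \<Longrightarrow> \<phi> (gen S a s) = c i a \<otimes>\<^bsub>S\<^esub> s"
    proof (rule gen_universal[OF S MS.R.abelian_group_axioms, of "\<lambda>a s. c i a \<otimes>\<^bsub>S\<^esub> s"])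
      fix a a' s assume a: "a \<in> carrier (Ob F Z)" "a' \<in> carrier (Ob F Z)" and s: "s \<in> carrier S"
      have "c i (a \<oplus>\<^bsub>Ob F Z\<^esub> a') = c i a \<oplus>\<^bsub>S\<^esub> c i a'"
        using a gc Q.coord_closed[OF i]
        by (simp add: c_def gen_add_left[OF Q a] additive_map_add[OF Q.coord_additive[OF i]] \<alpha>_add)
      then show "c i (a \<oplus>\<^bsub>Ob F Z\<^esub> a') \<otimes>\<^bsub>S\<^esub> s = c i a \<otimes>\<^bsub>S\<^esub> s \<oplus>\<^bsub>S\<^esub> c i a' \<otimes>\<^bsub>S\<^esub> s"
        using c[OF i] a s by (simp add: MS.R.l_distr)
    qed (use c[OF i] in \<open>simp_all add: MS.R.r_distr\<close>)
    then show ?thesis by blast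
  qed
  then obtain \<phi> where \<phi>: "\<And>i. i \<in> I \<Longrightarrow> \<phi> i \<in> hom (add_monoid (Ob F S)) (add_monoid S)"
    and \<phi>_gen: "\<And>i a s. \<lbrakk>i \<in> I; a \<in> carrier (Ob F Z); s \<in> carrier S\<rbrakk> \<Longrightarrow> \<phi> i (gen S a s) = c i a \<otimes>\<^bsub>S\<^esub> s"
    by metis
  have \<phi>_closed: "\<phi> i x \<in> carrier S" if "i \<in> I" "x \<in> carrier (Ob F S)" for i x
    by (rule additive_map_closed[OF \<phi>[OF that(1)] that(2)])
  have \<phi>_add: "\<phi> i (x \<oplus>\<^bsub>Ob F S\<^esub> y) = \<phi> i x \<oplus>\<^bsub>S\<^esub> \<phi> i y"
    if "i \<in> I" "x \<in> carrier (Ob F S)" "y \<in> carrier (Ob F S)" for i x y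
    by (rule additive_map_add[OF \<phi>[OF that(1)] that(2,3)])
  have \<phi>_Mor: "\<phi> i (Mor F Q S \<alpha> y) = \<alpha> (p i y)" if i: "i \<in> I" and y: "y \<in> carrier (Ob F Q)" for i y
    using Q y
  proof (induction rule: gen_induct)
    case (gen a q)
    have "gen Q a q = q \<odot>\<^bsub>Ob F Q\<^esub> gen Q a \<one>\<^bsub>Q\<^esub>"
      using gen by (simp add: smult_gen[OF Q])
    then have "\<alpha> (p i (gen Q a q)) = \<alpha> (q \<otimes>\<^bsub>Q\<^esub> p i (gen Q a \<one>\<^bsub>Q\<^esub>))"
      using gen i gc by (simp add: Q.coord_smult)
    also have "\<dots> = c i a \<otimes>\<^bsub>S\<^esub> \<alpha> q"
      using gen i gc Q.coord_closed[OF i] by (simp add: \<alpha>_mult c_def \<alpha>_closed MS.R.m_comm)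
    also have "\<dots> = \<phi> i (Mor F Q S \<alpha> (gen Q a q))"
      using gen i by (simp add: Mor_gen[OF Q S \<alpha>] \<phi>_gen \<alpha>_closed)
    finally show ?case by simp
  next
    case (add x y)
    then show ?case
      using i Q.coord_closed[OF i]
      by (simp add: Mor_add[OF Q S \<alpha>] Mor_closed[OF Q S \<alpha>] \<phi>_add \<alpha>_add additive_map_add[OF Q.coord_additive[OF i]])
  qed
  have e': "Mor F Q S \<alpha> (e i) \<in> carrier (Ob F S)" if "i \<in> I" for i
    by (rule Mor_closed[OF Q S \<alpha> Q.e_closed[OF that]])
  have "coordinate_system S (Ob F S) I (\<lambda>i. Mor F Q S \<alpha> (e i)) \<phi>"
  proof unfold_locales
    fix i r x assume i: "i \<in> I" and r: "r \<in> carrier S" and x: "x \<in> carrier (Ob F S)"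
    show "\<phi> i (r \<odot>\<^bsub>Ob F S\<^esub> x) = r \<otimes>\<^bsub>S\<^esub> \<phi> i x"
      using S x
    proof (induction rule: gen_induct)
      case (gen a s)
      then show ?case
        using i r c[OF i] by (simp add: smult_gen[OF S] \<phi>_gen MS.R.m_lcomm)
    next
      case (add x y)
      then show ?case
        using i r by (simp add: MS.smult_r_distr \<phi>_add \<phi>_closed MS.R.r_distr)
    qed
  next
    fix x assume "x \<in> carrier (Ob F S)"
    with S show "x = (\<Oplus>\<^bsub>Ob F S\<^esub>i\<in>I. \<phi> i x \<odot>\<^bsub>Ob F S\<^esub> Mor F Q S \<alpha> (e i))"
    proof (induction rule: gen_induct)
      case (gen a s)
      let ?g = "gen Q a \<one>\<^bsub>Q\<^esub>"
      have pc: "p i ?g \<in> carrier Q" if "i \<in> I" for i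
        by (rule Q.coord_closed[OF that gc[OF gen(1)]])
      have "gen S a s = s \<odot>\<^bsub>Ob F S\<^esub> Mor F Q S \<alpha> ?g"
        using gen by (simp add: smult_gen[OF S] Mor_gen[OF Q S \<alpha>] \<alpha>_one)
      also have "Mor F Q S \<alpha> ?g = Mor F Q S \<alpha> (\<Oplus>\<^bsub>Ob F Q\<^esub>i\<in>I. p i ?g \<odot>\<^bsub>Ob F Q\<^esub> e i)"
        using Q.expand[OF gc[OF gen(1)]] by simp
      also have "\<dots> = (\<Oplus>\<^bsub>Ob F S\<^esub>i\<in>I. Mor F Q S \<alpha> (p i ?g \<odot>\<^bsub>Ob F Q\<^esub> e i))"
        using pc Q.e_closed
        by (intro additive_map_finsum[OF abelian[OF Q] abelian[OF S] Mor_additive[OF Q S \<alpha>]]) auto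
      also have "\<dots> = (\<Oplus>\<^bsub>Ob F S\<^esub>i\<in>I. c i a \<odot>\<^bsub>Ob F S\<^esub> Mor F Q S \<alpha> (e i))"
        using pc Q.e_closed c gen e'
        by (intro MS.M.finsum_cong') (auto simp: Mor_smult[OF Q S \<alpha>] c_def)
      also have "s \<odot>\<^bsub>Ob F S\<^esub> \<dots> = (\<Oplus>\<^bsub>Ob F S\<^esub>i\<in>I. s \<odot>\<^bsub>Ob F S\<^esub> (c i a \<odot>\<^bsub>Ob F S\<^esub> Mor F Q S \<alpha> (e i)))"
        using gen c e' by (intro MS.finsum_smult) auto
      also have "\<dots> = (\<Oplus>\<^bsub>Ob F S\<^esub>i\<in>I. \<phi> i (gen S a s) \<odot>\<^bsub>Ob F S\<^esub> Mor F Q S \<alpha> (e i))"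
        using gen c e'
        by (intro MS.M.finsum_cong') (auto simp: \<phi>_gen MS.smult_assoc1[symmetric] MS.R.m_comm)
      finally show ?case .
    next
      case (add x y)
      have "x \<oplus>\<^bsub>Ob F S\<^esub> y = (\<Oplus>\<^bsub>Ob F S\<^esub>i\<in>I. \<phi> i x \<odot>\<^bsub>Ob F S\<^esub> Mor F Q S \<alpha> (e i))
          \<oplus>\<^bsub>Ob F S\<^esub> (\<Oplus>\<^bsub>Ob F S\<^esub>i\<in>I. \<phi> i y \<odot>\<^bsub>Ob F S\<^esub> Mor F Q S \<alpha> (e i))"
        using add.IH by simp
      also have "\<dots> = (\<Oplus>\<^bsub>Ob F S\<^esub>i\<in>I. \<phi> i x \<odot>\<^bsub>Ob F S\<^esub> Mor F Q S \<alpha> (e i) \<oplus>\<^bsub>Ob F S\<^esub> \<phi> i y \<odot>\<^bsub>Ob F S\<^esub> Mor F Q S \<alpha> (e i))"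
        using add.hyps e' \<phi>_closed by (intro MS.M.finsum_addf[symmetric]) auto
      also have "\<dots> = (\<Oplus>\<^bsub>Ob F S\<^esub>i\<in>I. \<phi> i (x \<oplus>\<^bsub>Ob F S\<^esub> y) \<odot>\<^bsub>Ob F S\<^esub> Mor F Q S \<alpha> (e i))"
        using add.hyps e' \<phi>_closed
        by (intro MS.M.finsum_cong') (auto simp: \<phi>_add MS.smult_l_distr)
      finally show ?case .
    qed
  next
    show "\<phi> i \<in> hom (add_monoid (Ob F S)) (add_monoid S)" if "i \<in> I" for i
      by (rule \<phi>[OF that])
  qed (simp_all add: Q.finite_index e' \<phi>_Mor Q.e_closed Q.coord_e \<alpha>_one \<alpha>_zero)
  then show thesis by (rule that)
qed

end

context invariant_functor
begin

lemma Mor_zero: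
  "\<lbrakk>S \<in> rng_obj; T \<in> rng_obj; \<beta> \<in> rng_hom S T\<rbrakk> \<Longrightarrow> Mor F S T \<beta> \<zero>\<^bsub>Ob F S\<^esub> = \<zero>\<^bsub>Ob F T\<^esub>"
  by (rule additive_map_zero[OF abelian abelian Mor_additive])

text \<open>
  Both sides are semilinear in \<open>z\<close> and agree on the basis.
\<close>

lemma coord_Mor:
  assumes S: "S \<in> rng_obj" and T: "T \<in> rng_obj" and \<beta>: "\<beta> \<in> rng_hom S T"
    and p: "coordinate_system S (Ob F S) I e p"
    and p': "coordinate_system T (Ob F T) I (\<lambda>i. Mor F S T \<beta> (e i)) p'"
    and i: "i \<in> I" and z: "z \<in> carrier (Ob F S)"
  shows "p' i (Mor F S T \<beta> z) = \<beta> (p i z)"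
proof -
  interpret p: coordinate_system S "Ob F S" I e p by fact
  interpret p': coordinate_system T "Ob F T" I "\<lambda>i. Mor F S T \<beta> (e i)" p' by fact
  have \<beta>_closed: "\<beta> q \<in> carrier T" if "q \<in> carrier S" for q
    using \<beta> that by (auto simp: rng_hom_def ring_hom_def)
  have \<beta>_add: "\<beta> (q \<oplus>\<^bsub>S\<^esub> r) = \<beta> q \<oplus>\<^bsub>T\<^esub> \<beta> r" and \<beta>_mult: "\<beta> (q \<otimes>\<^bsub>S\<^esub> r) = \<beta> q \<otimes>\<^bsub>T\<^esub> \<beta> r"
    if "q \<in> carrier S" "r \<in> carrier S" for q r
    using \<beta> that by (auto simp: rng_hom_def ring_hom_def)
  have \<beta>_one: "\<beta> \<one>\<^bsub>S\<^esub> = \<one>\<^bsub>T\<^esub>"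
    using \<beta> by (auto simp: rng_hom_def ring_hom_def)
  have \<beta>_zero: "\<beta> \<zero>\<^bsub>S\<^esub> = \<zero>\<^bsub>T\<^esub>"
    by (rule additive_map_zero[OF p.R.abelian_group_axioms p'.R.abelian_group_axioms rng_hom_additive[OF \<beta>]])
  have p0: "p i \<zero>\<^bsub>Ob F S\<^esub> = \<zero>\<^bsub>S\<^esub>"
    by (rule additive_map_zero[OF abelian[OF S] p.R.abelian_group_axioms p.coord_additive[OF i]])
  have p'0: "p' i \<zero>\<^bsub>Ob F T\<^esub> = \<zero>\<^bsub>T\<^esub>"
    by (rule additive_map_zero[OF abelian[OF T] p'.R.abelian_group_axioms p'.coord_additive[OF i]])
  show ?thesis
    using z
  proof (induction rule: p.coord_induct)
    case zero
    then show ?case by (simp add: Mor_zero[OF S T \<beta>] p0 p'0 \<beta>_zero)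
  next
    case (e j)
    then show ?case using i by (simp add: p.coord_e p'.coord_e \<beta>_one \<beta>_zero)
  next
    case (add x y)
    then show ?case
      using p.coord_closed[OF i]
      by (simp add: Mor_add[OF S T \<beta>] Mor_closed[OF S T \<beta>] \<beta>_add
          additive_map_add[OF p.coord_additive[OF i]] additive_map_add[OF p'.coord_additive[OF i]])
  next
    case (smult r x)
    then show ?case
      using p.coord_closed[OF i] i
      by (simp add: Mor_smult[OF S T \<beta>] Mor_closed[OF S T \<beta>] \<beta>_mult p.coord_smult p'.coord_smult \<beta>_closed)
  qed
qed

lemma Mor_inj:
  assumes S: "S \<in> rng_obj" and T: "T \<in> rng_obj" and \<beta>: "\<beta> \<in> rng_hom S T"
    and p: "coordinate_system S (Ob F S) I e p"
    and p': "coordinate_system T (Ob F T) I (\<lambda>i. Mor F S T \<beta> (e i)) p'"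
    and inj: "inj_on \<beta> (carrier S)"
  shows "inj_on (Mor F S T \<beta>) (carrier (Ob F S))"
proof (rule inj_onI)
  interpret p: coordinate_system S "Ob F S" I e p by fact
  fix z z' assume z: "z \<in> carrier (Ob F S)" "z' \<in> carrier (Ob F S)"
    and eq: "Mor F S T \<beta> z = Mor F S T \<beta> z'"
  show "z = z'"
  proof (rule p.coord_eqI[OF z])
    fix i assume i: "i \<in> I"
    have "\<beta> (p i z) = \<beta> (p i z')"
      using coord_Mor[OF S T \<beta> p p' i] z eq by metis
    then show "p i z = p i z'"
      using inj_onD[OF inj] p.coord_closed[OF i] z by blast
  qed
qed

text \<open>
  The preimages in \<open>S\<close> of the coordinates of \<open>m\<close> are the coordinates of an element of \<open>F(S)\<close>.
\<close>

lemma Mor_image: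
  assumes S: "S \<in> rng_obj" and T: "T \<in> rng_obj" and \<beta>: "\<beta> \<in> rng_hom S T"
    and p: "coordinate_system S (Ob F S) I e p"
    and p': "coordinate_system T (Ob F T) I (\<lambda>i. Mor F S T \<beta> (e i)) p'"
    and m: "m \<in> carrier (Ob F T)" and im: "\<And>i. i \<in> I \<Longrightarrow> p' i m \<in> \<beta> ` carrier S"
  shows "m \<in> Mor F S T \<beta> ` carrier (Ob F S)"
proof -
  interpret p: coordinate_system S "Ob F S" I e p by fact
  interpret p': coordinate_system T "Ob F T" I "\<lambda>i. Mor F S T \<beta> (e i)" p' by fact
  have "\<forall>i\<in>I. \<exists>c. c \<in> carrier S \<and> p' i m = \<beta> c" using im by blast
  then obtain c where c: "\<And>i. i \<in> I \<Longrightarrow> c i \<in> carrier S" "\<And>i. i \<in> I \<Longrightarrow> p' i m = \<beta> (c i)"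
    by metis
  obtain z where z: "z \<in> carrier (Ob F S)" "\<And>i. i \<in> I \<Longrightarrow> p i z = c i"
    using p.coord_exists[of c] c(1) by blast
  have "m = Mor F S T \<beta> z"
    using m Mor_closed[OF S T \<beta> z(1)]
    by (rule p'.coord_eqI) (simp add: coord_Mor[OF S T \<beta> p p' _ z(1)] c z(2))
  with z(1) show ?thesis by blast
qed

end

section \<open>Descent of finite dimension to a subfield\<close>

text \<open>
  A complement \<open>W\<close> of the line \<open>Q\<close> in the \<open>Q\<close>-vector space \<open>K\<close> is a \<open>Q\<close>-subspace that is maximal
  among those not containing \<open>1\<close>.
\<close>

lemma subfield_additive_retraction:
  assumes K: "field K" and Q: "subfield Q K"
  obtains \<rho> where "\<rho> \<in> hom (add_monoid K) (add_monoid (K\<lparr>carrier := Q\<rparr>))"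
    and "\<And>q. q \<in> Q \<Longrightarrow> \<rho> q = q"
proof -
  interpret K: field K by fact
  note Qs = subfieldE(3)[OF Q] subringE[OF subfieldE(1)[OF Q]]
  define \<W> where "\<W> = {W. W \<subseteq> carrier K \<and> \<zero>\<^bsub>K\<^esub> \<in> W \<and> (\<forall>x\<in>W. \<forall>y\<in>W. x \<oplus>\<^bsub>K\<^esub> y \<in> W)
    \<and> (\<forall>q\<in>Q. \<forall>x\<in>W. q \<otimes>\<^bsub>K\<^esub> x \<in> W) \<and> \<one>\<^bsub>K\<^esub> \<notin> W}"
  have "{\<zero>\<^bsub>K\<^esub>} \<in> \<W>"
    using Qs(1) by (auto simp: \<W>_def)
  moreover have "\<Union>\<C> \<in> \<W>" if "\<C> \<noteq> {}" "subset.chain \<W> \<C>" for \<C>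
  proof -
    have sub: "\<C> \<subseteq> \<W>" using that(2) by (simp add: subset_chain_def)
    have "x \<oplus>\<^bsub>K\<^esub> y \<in> \<Union>\<C>" if "U \<in> \<C>" "x \<in> U" "V \<in> \<C>" "y \<in> V" for x y U V
    proof -
      have "U \<subseteq> V \<or> V \<subseteq> U"
        using \<open>subset.chain \<W> \<C>\<close> that by (simp add: subset_chain_def)
      then show ?thesis
        using that sub unfolding \<W>_def by blast
    qed
    moreover have "\<zero>\<^bsub>K\<^esub> \<in> \<Union>\<C>" using that(1) sub unfolding \<W>_def by blast
    moreover have "\<Union>\<C> \<subseteq> carrier K" "\<one>\<^bsub>K\<^esub> \<notin> \<Union>\<C>" using sub unfolding \<W>_def by blast+
    moreover have "q \<otimes>\<^bsub>K\<^esub> x \<in> \<Union>\<C>" if "q \<in> Q" "x \<in> \<Union>\<C>" for q x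
      using that sub unfolding \<W>_def by blast
    ultimately show ?thesis
      unfolding \<W>_def by blast
  qed
  ultimately obtain W where W: "W \<in> \<W>" and max: "\<And>W'. \<lbrakk>W' \<in> \<W>; W \<subseteq> W'\<rbrakk> \<Longrightarrow> W' = W"
    using subset_Zorn_nonempty[of \<W>] by blast
  have WK: "W \<subseteq> carrier K" and W0: "\<zero>\<^bsub>K\<^esub> \<in> W" and W1: "\<one>\<^bsub>K\<^esub> \<notin> W"
    and Wadd: "\<And>x y. \<lbrakk>x \<in> W; y \<in> W\<rbrakk> \<Longrightarrow> x \<oplus>\<^bsub>K\<^esub> y \<in> W"
    and Wmult: "\<And>q x. \<lbrakk>q \<in> Q; x \<in> W\<rbrakk> \<Longrightarrow> q \<otimes>\<^bsub>K\<^esub> x \<in> W"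
    using W unfolding \<W>_def by blast+
  have Wneg: "\<ominus>\<^bsub>K\<^esub> x \<in> W" if "x \<in> W" for x
  proof -
    have "\<ominus>\<^bsub>K\<^esub> \<one>\<^bsub>K\<^esub> \<in> Q" using Qs by blast
    then have "(\<ominus>\<^bsub>K\<^esub> \<one>\<^bsub>K\<^esub>) \<otimes>\<^bsub>K\<^esub> x \<in> W" using Wmult that by blast
    then show ?thesis using that WK by (auto simp: K.l_minus subset_iff)
  qed
  have QW: "q = \<zero>\<^bsub>K\<^esub>" if "q \<in> Q" "q \<in> W" for q
  proof (rule ccontr)
    assume "q \<noteq> \<zero>\<^bsub>K\<^esub>"
    then have "inv\<^bsub>K\<^esub> q \<in> Q" "inv\<^bsub>K\<^esub> q \<otimes>\<^bsub>K\<^esub> q = \<one>\<^bsub>K\<^esub>"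
      using K.subfield_m_inv[OF Q, of q] that by simp_all
    then show False using Wmult[of "inv\<^bsub>K\<^esub> q" q] that W1 by simp
  qed
  have ex: "\<exists>q\<in>Q. x \<ominus>\<^bsub>K\<^esub> q \<in> W" if x: "x \<in> carrier K" for x
  proof (cases "x \<in> W")
    case True
    then show ?thesis using Qs x by (intro bexI[of _ "\<zero>\<^bsub>K\<^esub>"]) (simp_all add: a_minus_def)
  next
    case False
    \<comment> \<open>By maximality of \<open>W\<close> the subspace \<open>W + Q x\<close> contains \<open>1\<close>, and solving for \<open>x\<close> puts it in \<open>W + Q\<close>.\<close>
    define W' where "W' = {w \<oplus>\<^bsub>K\<^esub> a \<otimes>\<^bsub>K\<^esub> x |w a. w \<in> W \<and> a \<in> Q}"
    have mem: "w \<oplus>\<^bsub>K\<^esub> a \<otimes>\<^bsub>K\<^esub> x \<in> W'" if "w \<in> W" "a \<in> Q" for w a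
      using that unfolding W'_def by blast
    have K': "w \<in> carrier K" if "w \<in> W" for w using that WK by blast
    have Q': "a \<in> carrier K" if "a \<in> Q" for a using that Qs by blast
    have sub: "W \<subseteq> W'"
    proof
      fix w assume w: "w \<in> W"
      show "w \<in> W'" using mem[OF w, of "\<zero>\<^bsub>K\<^esub>"] Qs(3) K'[OF w] x by simp
    qed
    have "x \<in> W'" using mem[OF W0, of "\<one>\<^bsub>K\<^esub>"] Qs(4) x by simp
    with False max sub have "W' \<notin> \<W>" by blast
    moreover have "W' \<subseteq> carrier K" unfolding W'_def using K' Q' x by auto
    moreover have "\<zero>\<^bsub>K\<^esub> \<in> W'" using sub W0 by blast
    moreover have "u \<oplus>\<^bsub>K\<^esub> v \<in> W'" if uv: "u \<in> W'" "v \<in> W'" for u v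
    proof -
      obtain w a where u: "u = w \<oplus>\<^bsub>K\<^esub> a \<otimes>\<^bsub>K\<^esub> x" and m: "w \<in> W" "a \<in> Q"
        using uv(1) unfolding W'_def by blast
      obtain w' a' where v: "v = w' \<oplus>\<^bsub>K\<^esub> a' \<otimes>\<^bsub>K\<^esub> x" and m': "w' \<in> W" "a' \<in> Q"
        using uv(2) unfolding W'_def by blast
      have "u \<oplus>\<^bsub>K\<^esub> v = (w \<oplus>\<^bsub>K\<^esub> w') \<oplus>\<^bsub>K\<^esub> (a \<oplus>\<^bsub>K\<^esub> a') \<otimes>\<^bsub>K\<^esub> x"
        using m m' K' Q' x by (simp add: u v K.l_distr K.a_ac)
      then show ?thesis using mem[of "w \<oplus>\<^bsub>K\<^esub> w'" "a \<oplus>\<^bsub>K\<^esub> a'"] m m' Wadd Qs(8) by simp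
    qed
    moreover have "q \<otimes>\<^bsub>K\<^esub> u \<in> W'" if qu: "q \<in> Q" "u \<in> W'" for q u
    proof -
      obtain w a where u: "u = w \<oplus>\<^bsub>K\<^esub> a \<otimes>\<^bsub>K\<^esub> x" and m: "w \<in> W" "a \<in> Q"
        using qu(2) unfolding W'_def by blast
      have "q \<otimes>\<^bsub>K\<^esub> u = q \<otimes>\<^bsub>K\<^esub> w \<oplus>\<^bsub>K\<^esub> (q \<otimes>\<^bsub>K\<^esub> a) \<otimes>\<^bsub>K\<^esub> x"
        using m K' Q' x that by (simp add: u K.r_distr K.m_assoc)
      then show ?thesis using mem[of "q \<otimes>\<^bsub>K\<^esub> w" "q \<otimes>\<^bsub>K\<^esub> a"] m Wmult Qs(7) that by simp
    qed
    ultimately have "\<one>\<^bsub>K\<^esub> \<in> W'" unfolding \<W>_def by blast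
    then obtain w a where one: "\<one>\<^bsub>K\<^esub> = w \<oplus>\<^bsub>K\<^esub> a \<otimes>\<^bsub>K\<^esub> x" and m: "w \<in> W" "a \<in> Q"
      unfolding W'_def by blast
    have "a \<noteq> \<zero>\<^bsub>K\<^esub>"
    proof
      assume "a = \<zero>\<^bsub>K\<^esub>"
      then have "\<one>\<^bsub>K\<^esub> = w" using one m K' x by simp
      then show False using W1 m by simp
    qed
    then have b: "inv\<^bsub>K\<^esub> a \<in> Q" "inv\<^bsub>K\<^esub> a \<otimes>\<^bsub>K\<^esub> a = \<one>\<^bsub>K\<^esub>"
      using K.subfield_m_inv[OF Q, of a] m by simp_all
    have "inv\<^bsub>K\<^esub> a = inv\<^bsub>K\<^esub> a \<otimes>\<^bsub>K\<^esub> (w \<oplus>\<^bsub>K\<^esub> a \<otimes>\<^bsub>K\<^esub> x)"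
      using Q'[OF b(1)] by (simp add: one[symmetric])
    also have "\<dots> = inv\<^bsub>K\<^esub> a \<otimes>\<^bsub>K\<^esub> w \<oplus>\<^bsub>K\<^esub> x"
      using b m K' Q' x by (simp add: K.r_distr K.m_assoc[symmetric])
    finally have "x \<ominus>\<^bsub>K\<^esub> inv\<^bsub>K\<^esub> a = x \<ominus>\<^bsub>K\<^esub> (inv\<^bsub>K\<^esub> a \<otimes>\<^bsub>K\<^esub> w \<oplus>\<^bsub>K\<^esub> x)" by simp
    also have "\<dots> = \<ominus>\<^bsub>K\<^esub> (inv\<^bsub>K\<^esub> a \<otimes>\<^bsub>K\<^esub> w)"
      using b m K' Q' x by (simp add: a_minus_def K.minus_add K.a_ac K.r_neg2)
    finally show ?thesis using b(1) m Wmult Wneg by (intro bexI[of _ "inv\<^bsub>K\<^esub> a"]) simp_all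
  qed
  have uniq: "q = r" if "x \<in> carrier K" "q \<in> Q" "r \<in> Q" "x \<ominus>\<^bsub>K\<^esub> q \<in> W" "x \<ominus>\<^bsub>K\<^esub> r \<in> W" for x q r
  proof -
    have c: "q \<in> carrier K" "r \<in> carrier K" using that Qs by blast+
    have "(x \<ominus>\<^bsub>K\<^esub> r) \<oplus>\<^bsub>K\<^esub> \<ominus>\<^bsub>K\<^esub> (x \<ominus>\<^bsub>K\<^esub> q) = (\<ominus>\<^bsub>K\<^esub> r \<oplus>\<^bsub>K\<^esub> x) \<oplus>\<^bsub>K\<^esub> (\<ominus>\<^bsub>K\<^esub> x \<oplus>\<^bsub>K\<^esub> q)"
      using c that(1) by (simp add: a_minus_def K.minus_add K.a_comm[of x "\<ominus>\<^bsub>K\<^esub> r"])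
    also have "\<dots> = \<ominus>\<^bsub>K\<^esub> r \<oplus>\<^bsub>K\<^esub> (x \<oplus>\<^bsub>K\<^esub> (\<ominus>\<^bsub>K\<^esub> x \<oplus>\<^bsub>K\<^esub> q))"
      using c that(1) by (simp only: K.a_assoc K.a_inv_closed K.a_closed)
    also have "\<dots> = q \<ominus>\<^bsub>K\<^esub> r"
      using c that(1) by (simp add: K.r_neg2 a_minus_def K.a_comm[of q])
    finally have "(x \<ominus>\<^bsub>K\<^esub> r) \<oplus>\<^bsub>K\<^esub> \<ominus>\<^bsub>K\<^esub> (x \<ominus>\<^bsub>K\<^esub> q) = q \<ominus>\<^bsub>K\<^esub> r" .
    then have "q \<ominus>\<^bsub>K\<^esub> r \<in> W" using Wadd[OF that(5) Wneg[OF that(4)]] by simp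
    moreover have "q \<ominus>\<^bsub>K\<^esub> r \<in> Q" using that(2,3) Qs by (simp add: a_minus_def)
    ultimately have "q \<ominus>\<^bsub>K\<^esub> r = \<zero>\<^bsub>K\<^esub>" using QW by blast
    then show ?thesis using c by (simp add: K.r_right_minus_eq)
  qed
  define \<rho> where "\<rho> x = (THE q. q \<in> Q \<and> x \<ominus>\<^bsub>K\<^esub> q \<in> W)" for x
  have \<rho>_eq: "\<rho> x = q" if "x \<in> carrier K" "q \<in> Q" "x \<ominus>\<^bsub>K\<^esub> q \<in> W" for x q
    unfolding \<rho>_def using uniq[OF that(1)] that by (intro the_equality) blast+
  have \<rho>: "\<rho> x \<in> Q" "x \<ominus>\<^bsub>K\<^esub> \<rho> x \<in> W" if x: "x \<in> carrier K" for x
  proof -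
    obtain q where "q \<in> Q" "x \<ominus>\<^bsub>K\<^esub> q \<in> W" using ex[OF x] by blast
    with \<rho>_eq[OF x] show "\<rho> x \<in> Q" "x \<ominus>\<^bsub>K\<^esub> \<rho> x \<in> W" by simp_all
  qed
  have "\<rho> \<in> hom (add_monoid K) (add_monoid (K\<lparr>carrier := Q\<rparr>))"
  proof (rule homI)
    fix x y assume "x \<in> carrier (add_monoid K)" "y \<in> carrier (add_monoid K)"
    then have xy: "x \<in> carrier K" "y \<in> carrier K" by simp_all
    have c: "\<rho> x \<in> carrier K" "\<rho> y \<in> carrier K" using \<rho>(1) xy Qs by blast+
    have "(x \<oplus>\<^bsub>K\<^esub> y) \<ominus>\<^bsub>K\<^esub> (\<rho> x \<oplus>\<^bsub>K\<^esub> \<rho> y) = (x \<ominus>\<^bsub>K\<^esub> \<rho> x) \<oplus>\<^bsub>K\<^esub> (y \<ominus>\<^bsub>K\<^esub> \<rho> y)"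
      using xy c by (simp add: a_minus_def K.minus_add K.a_ac)
    then have "\<rho> (x \<oplus>\<^bsub>K\<^esub> y) = \<rho> x \<oplus>\<^bsub>K\<^esub> \<rho> y"
      using xy \<rho>(1)[OF xy(1)] \<rho>(1)[OF xy(2)] Qs(8) Wadd[OF \<rho>(2)[OF xy(1)] \<rho>(2)[OF xy(2)]]
      by (intro \<rho>_eq) simp_all
    then show "\<rho> (x \<otimes>\<^bsub>add_monoid K\<^esub> y) = \<rho> x \<otimes>\<^bsub>add_monoid (K\<lparr>carrier := Q\<rparr>)\<^esub> \<rho> y" by simp
  qed (use \<rho>(1) in simp)
  moreover have "\<rho> q = q" if "q \<in> Q" for q
  proof (rule \<rho>_eq)
    show "q \<in> carrier K" using that Qs by blast
    then show "q \<ominus>\<^bsub>K\<^esub> q \<in> W" using W0 by (simp add: a_minus_def K.r_neg)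
  qed fact
  ultimately show thesis using that by blast
qed

text \<open>
  An additive retraction \<open>\<rho>: K \<rightarrow> Q\<close> induces an additive map \<open>\<theta>: F(K) \<rightarrow> F(Q)\<close>, \<open>a \<otimes> k \<mapsto> a \<otimes> \<rho>(k)\<close>,
  which is onto since \<open>\<rho>\<close> is. The image of a line \<open>K (a \<otimes> l)\<close> lies in the line spanned by
  \<open>a \<otimes> 1\<close>, so the image of each line of \<open>F(K)\<close> lies in a finite-dimensional subspace; as \<open>F(K)\<close> is
  a sum of finitely many lines, \<open>F(Q)\<close> is finite-dimensional.
\<close>

lemma (in invariant_functor) fin_dim_subfield:
  assumes K: "field K" and Q: "subfield Q K" and fd: "vectorspace.fin_dim K (Ob F K)"
  shows "vectorspace.fin_dim (K\<lparr>carrier := Q\<rparr>) (Ob F (K\<lparr>carrier := Q\<rparr>))"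
proof -
  let ?Q = "K\<lparr>carrier := Q\<rparr>"
  interpret K: field K by fact
  interpret Q: field ?Q using K.subfield_iff(2)[OF Q] .
  have Ko: "K \<in> rng_obj" using K.is_cring K.one_not_zero by (simp add: rng_obj_def)
  have Qo: "?Q \<in> rng_obj" using Q.is_cring Q.one_not_zero by (simp add: rng_obj_def)
  interpret VK: vectorspace K "Ob F K"
    using module[OF Ko] K by (simp add: vectorspace_def)
  interpret VQ: vectorspace ?Q "Ob F ?Q"
    using module[OF Qo] Q.field_axioms by (simp add: vectorspace_def)
  obtain \<rho> where \<rho>: "\<rho> \<in> hom (add_monoid K) (add_monoid ?Q)" and \<rho>_id: "\<And>q. q \<in> Q \<Longrightarrow> \<rho> q = q"
    using subfield_additive_retraction[OF K Q] by blast
  have \<rho>_closed: "\<rho> k \<in> Q" if "k \<in> carrier K" for k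
    using additive_map_closed[OF \<rho> that] by simp
  have \<rho>_add: "\<rho> (k \<oplus>\<^bsub>K\<^esub> l) = \<rho> k \<oplus>\<^bsub>?Q\<^esub> \<rho> l" if "k \<in> carrier K" "l \<in> carrier K" for k l
    by (rule additive_map_add[OF \<rho> that])
  have QK: "q \<in> carrier K" if "q \<in> Q" for q using subfieldE(3)[OF Q] that by blast
  obtain \<theta> where \<theta>: "\<theta> \<in> hom (add_monoid (Ob F K)) (add_monoid (Ob F ?Q))"
    and \<theta>_gen: "\<And>a k. \<lbrakk>a \<in> carrier (Ob F Z); k \<in> carrier K\<rbrakk> \<Longrightarrow> \<theta> (gen K a k) = gen ?Q a (\<rho> k)"
  proof (rule gen_universal[OF Ko abelian[OF Qo], of "\<lambda>a k. gen ?Q a (\<rho> k)"])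
    fix a k assume "a \<in> carrier (Ob F Z)" "k \<in> carrier K"
    then show "gen ?Q a (\<rho> k) \<in> carrier (Ob F ?Q)"
      using gen_closed[OF Qo] \<rho>_closed by simp
  next
    fix a a' k assume a: "a \<in> carrier (Ob F Z)" "a' \<in> carrier (Ob F Z)" "k \<in> carrier K"
    then show "gen ?Q (a \<oplus>\<^bsub>Ob F Z\<^esub> a') (\<rho> k) = gen ?Q a (\<rho> k) \<oplus>\<^bsub>Ob F ?Q\<^esub> gen ?Q a' (\<rho> k)"
      using gen_add_left[OF Qo a(1,2)] \<rho>_closed by simp
  next
    fix a k l assume a: "a \<in> carrier (Ob F Z)" "k \<in> carrier K" "l \<in> carrier K"
    then show "gen ?Q a (\<rho> (k \<oplus>\<^bsub>K\<^esub> l)) = gen ?Q a (\<rho> k) \<oplus>\<^bsub>Ob F ?Q\<^esub> gen ?Q a (\<rho> l)"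
      using gen_add_right[OF Qo a(1)] \<rho>_closed \<rho>_add by simp
  qed (rule that)
  \<comment> \<open>The space spanned by \<open>E\<close> contains the image of the line through \<open>v\<close>.\<close>
  define fin_span where "fin_span E v \<longleftrightarrow> finite E \<and> E \<subseteq> carrier (Ob F ?Q) \<and>
      (\<forall>k\<in>carrier K. \<theta> (k \<odot>\<^bsub>Ob F K\<^esub> v) \<in> VQ.span E)" for E v
  have span_add: "u \<oplus>\<^bsub>Ob F ?Q\<^esub> v \<in> VQ.span E"
    if "E \<subseteq> carrier (Ob F ?Q)" "u \<in> VQ.span E" "v \<in> VQ.span E" for E u v
    using LinearCombinations.submodule.m_closed[OF VQ.span_is_submodule[OF that(1)] that(2,3)] .
  have span_smult: "r \<odot>\<^bsub>Ob F ?Q\<^esub> u \<in> VQ.span E"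
    if "E \<subseteq> carrier (Ob F ?Q)" "r \<in> Q" "u \<in> VQ.span E" for E r u
    using LinearCombinations.submodule.smult_closed[OF VQ.span_is_submodule[OF that(1)], of r u] that by simp
  have ex: "\<exists>E. fin_span E v" if v: "v \<in> carrier (Ob F K)" for v
    using Ko v
  proof (induction rule: gen_induct)
    case (gen a l)
    let ?E = "{gen ?Q a \<one>\<^bsub>K\<^esub>}"
    have g: "gen ?Q a \<one>\<^bsub>K\<^esub> \<in> carrier (Ob F ?Q)"
      using gen_closed[OF Qo gen(1)] Q.one_closed by simp
    have "\<theta> (k \<odot>\<^bsub>Ob F K\<^esub> gen K a l) \<in> VQ.span ?E" if k: "k \<in> carrier K" for k
    proof -
      have r: "\<rho> (k \<otimes>\<^bsub>K\<^esub> l) \<in> Q" using k gen \<rho>_closed by simp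
      have "\<theta> (k \<odot>\<^bsub>Ob F K\<^esub> gen K a l) = gen ?Q a (\<rho> (k \<otimes>\<^bsub>K\<^esub> l))"
        using k gen by (simp add: smult_gen[OF Ko] \<theta>_gen)
      also have "\<dots> = \<rho> (k \<otimes>\<^bsub>K\<^esub> l) \<odot>\<^bsub>Ob F ?Q\<^esub> gen ?Q a \<one>\<^bsub>K\<^esub>"
        using smult_gen[OF Qo _ gen(1), of "\<rho> (k \<otimes>\<^bsub>K\<^esub> l)" "\<one>\<^bsub>K\<^esub>"] r QK[OF r] Q.one_closed by simp
      finally show ?thesis
        using span_smult[of ?E _ "gen ?Q a \<one>\<^bsub>K\<^esub>"] VQ.in_own_span[of ?E] g r by simp
    qed
    then show ?case using g by (intro exI[of _ ?E]) (simp add: fin_span_def)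
  next
    case (add v w)
    then obtain E E' where E: "fin_span E v" "fin_span E' w" by blast
    have "\<theta> (k \<odot>\<^bsub>Ob F K\<^esub> (v \<oplus>\<^bsub>Ob F K\<^esub> w)) \<in> VQ.span (E \<union> E')" if k: "k \<in> carrier K" for k
    proof -
      have "\<theta> (k \<odot>\<^bsub>Ob F K\<^esub> (v \<oplus>\<^bsub>Ob F K\<^esub> w)) = \<theta> (k \<odot>\<^bsub>Ob F K\<^esub> v) \<oplus>\<^bsub>Ob F ?Q\<^esub> \<theta> (k \<odot>\<^bsub>Ob F K\<^esub> w)"
        using add.hyps k by (simp add: VK.smult_r_distr additive_map_add[OF \<theta>])
      moreover have "\<theta> (k \<odot>\<^bsub>Ob F K\<^esub> v) \<in> VQ.span (E \<union> E')" "\<theta> (k \<odot>\<^bsub>Ob F K\<^esub> w) \<in> VQ.span (E \<union> E')"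
        using E k VQ.span_is_monotone[of E "E \<union> E'"] VQ.span_is_monotone[of E' "E \<union> E'"]
        unfolding fin_span_def by auto
      ultimately show ?thesis
        using E by (simp add: span_add fin_span_def)
    qed
    then show ?case using E by (intro exI[of _ "E \<union> E'"]) (simp add: fin_span_def)
  qed
  obtain V where V: "finite V" "V \<subseteq> carrier (Ob F K)" "VK.span V = carrier (Ob F K)"
    using fd unfolding VK.fin_dim_def by blast
  obtain E where E: "\<And>v. v \<in> V \<Longrightarrow> fin_span (E v) v"
    using ex V(2) by (metis subsetD)
  define B where "B = (\<Union>v\<in>V. E v)"
  have B: "finite B" "B \<subseteq> carrier (Ob F ?Q)"
    using E V(1) by (auto simp: B_def fin_span_def)
  define N where "N = {v \<in> carrier (Ob F K). \<forall>k\<in>carrier K. \<theta> (k \<odot>\<^bsub>Ob F K\<^esub> v) \<in> VQ.span B}"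
  have \<theta>0: "\<theta> \<zero>\<^bsub>Ob F K\<^esub> \<in> VQ.span B"
    using additive_map_zero[OF abelian[OF Ko] abelian[OF Qo] \<theta>]
      LinearCombinations.submodule.zero_closed[OF VQ.span_is_submodule[OF B(2)]] by simp
  have "LinearCombinations.submodule K N (Ob F K)"
  proof (rule LinearCombinations.submodule.intro[OF VK.module_axioms])
    show "N \<subseteq> carrier (Ob F K)" by (auto simp: N_def)
    show "\<zero>\<^bsub>Ob F K\<^esub> \<in> N" using \<theta>0 by (simp add: N_def)
  next
    fix r v assume r: "r \<in> carrier K" and v: "v \<in> N"
    show "r \<odot>\<^bsub>Ob F K\<^esub> v \<in> N"
      using v r by (simp add: N_def VK.smult_assoc1[symmetric])
  next
    fix v w assume "v \<in> N" "w \<in> N"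
    then show "v \<oplus>\<^bsub>Ob F K\<^esub> w \<in> N"
      using span_add[OF B(2)] by (simp add: N_def VK.smult_r_distr additive_map_add[OF \<theta>])
  qed
  moreover have "V \<subseteq> N"
  proof
    fix v assume v: "v \<in> V"
    have "VQ.span (E v) \<subseteq> VQ.span B"
      using v by (intro VQ.span_is_monotone) (auto simp: B_def)
    then show "v \<in> N" using E[OF v] V(2) v by (auto simp: N_def fin_span_def)
  qed
  ultimately have "carrier (Ob F K) \<subseteq> N"
    using VK.span_is_subset[of V N] V(3) by simp
  then have in_span: "\<theta> v \<in> VQ.span B" if "v \<in> carrier (Ob F K)" for v
    using that VK.smult_one[OF that] K.one_closed unfolding N_def by fastforce
  have "y \<in> VQ.span B" if "y \<in> carrier (Ob F ?Q)" for y
    using Qo that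
  proof (induction rule: gen_induct)
    case (gen a q)
    then have q: "q \<in> Q" "q \<in> carrier K" using QK by simp_all
    have "\<theta> (gen K a q) \<in> VQ.span B"
      by (rule in_span[OF gen_closed[OF Ko gen(1) q(2)]])
    then show ?case using \<theta>_gen[OF gen(1) q(2)] \<rho>_id[OF q(1)] by simp
  qed (rule span_add[OF B(2)])
  then have "VQ.span B = carrier (Ob F ?Q)"
    using VQ.span_is_subset2[OF B(2)] by blast
  then show ?thesis
    unfolding VQ.fin_dim_def using B by blast
qed

lemma (in invariant_functor) coordinates_over_subfield:
  assumes K: "field K" and Q: "subfield Q K" and fd: "vectorspace.fin_dim K (Ob F K)"
  obtains I :: "'b set" and e p
    where "coordinate_system (K\<lparr>carrier := Q\<rparr>) (Ob F (K\<lparr>carrier := Q\<rparr>)) I e p"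
proof -
  let ?Q = "K\<lparr>carrier := Q\<rparr>"
  interpret K: field K by fact
  interpret Q: field ?Q using K.subfield_iff(2)[OF Q] .
  have Qo: "?Q \<in> rng_obj" using Q.is_cring Q.one_not_zero by (simp add: rng_obj_def)
  interpret VQ: vectorspace ?Q "Ob F ?Q"
    using module[OF Qo] Q.field_axioms by (simp add: vectorspace_def)
  obtain B where "finite B" "VQ.basis B"
    using VQ.finite_basis_exists[OF fin_dim_subfield[OF K Q fd]] by blast
  then show thesis
    using VQ.finite_basis_coordinates that by blast
qed

text \<open>
  The prime field is the field generated by the empty set.
\<close>

lemma prime_field_subfield:
  assumes "field K"
  shows "subfield (prime_field K) K"
proof -
  interpret field K by fact
  have "generate_field K {} \<subseteq> L" if "subfield L K" for L
    by (rule generate_field_min_subfield1[OF _ that]) simp_all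
  then have "prime_field K = generate_field K {}"
    using generate_field_is_subfield[of "{}"] by (auto simp: prime_field_def)
  then show ?thesis using generate_field_is_subfield[of "{}"] by simp
qed

section \<open>Specialising isomorphisms\<close>

text \<open>
  On \<open>F(B)\<close> the homomorphism \<open>h\<close> is given by coefficients in \<open>B\<close>; the map \<open>h'\<close> has the images of
  these coefficients under \<open>\<eta>\<close>. Multiplicativity is an identity in \<open>G(B)\<close>, where it can be
  verified after passing to \<open>G(K)\<close>, since \<open>G(B)\<close> embeds into \<open>G(K)\<close>. The last conclusion says that
  \<open>h\<close> and \<open>h'\<close> are induced by the same map \<open>F(B) \<rightarrow> G(B)\<close>.
\<close>

lemma hom_specialises:
  assumes F: "invariant_functor Z F" and G: "invariant_functor Z G"
    and obj: "B \<in> rng_obj" "K \<in> rng_obj" "R \<in> rng_obj"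
    and \<iota>: "\<iota> \<in> rng_hom B K" "inj_on \<iota> (carrier B)" and \<eta>: "\<eta> \<in> rng_hom B R"
    and p: "coordinate_system B (Ob F B) I e p"
    and pR: "coordinate_system R (Ob F R) I (\<lambda>i. Mor F B R \<eta> (e i)) pR"
    and q: "coordinate_system B (Ob G B) J d q"
    and qK: "coordinate_system K (Ob G K) J (\<lambda>i. Mor G B K \<iota> (d i)) qK"
    and h: "h \<in> module_hom K (Ob F K) (Ob G K)" "h \<in> hom (Ob F K) (Ob G K)"
    and im: "\<And>i. i \<in> I \<Longrightarrow> h (Mor F B K \<iota> (e i)) \<in> Mor G B K \<iota> ` carrier (Ob G B)"
  obtains h' where "h' \<in> module_hom R (Ob F R) (Ob G R)" "h' \<in> hom (Ob F R) (Ob G R)"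
    and "\<And>z. z \<in> carrier (Ob F B) \<Longrightarrow>
      \<exists>w\<in>carrier (Ob G B). h (Mor F B K \<iota> z) = Mor G B K \<iota> w \<and> h' (Mor F B R \<eta> z) = Mor G B R \<eta> w"
proof -
  interpret F: invariant_functor Z F by fact
  interpret G: invariant_functor Z G by fact
  interpret p: coordinate_system B "Ob F B" I e p by fact
  interpret pR: coordinate_system R "Ob F R" I "\<lambda>i. Mor F B R \<eta> (e i)" pR by fact
  note Fm\<iota> = F.Mor_add[OF obj(1,2) \<iota>(1)] F.Mor_smult[OF obj(1,2) \<iota>(1)] F.Mor_closed[OF obj(1,2) \<iota>(1)]
    F.Mor_mult[OF obj(1,2) \<iota>(1)] F.Mor_zero[OF obj(1,2) \<iota>(1)]
  note Fm\<eta> = F.Mor_add[OF obj(1,3) \<eta>] F.Mor_smult[OF obj(1,3) \<eta>] F.Mor_closed[OF obj(1,3) \<eta>]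
    F.Mor_mult[OF obj(1,3) \<eta>] F.Mor_zero[OF obj(1,3) \<eta>]
  note Gm\<iota> = G.Mor_add[OF obj(1,2) \<iota>(1)] G.Mor_smult[OF obj(1,2) \<iota>(1)] G.Mor_closed[OF obj(1,2) \<iota>(1)]
    G.Mor_mult[OF obj(1,2) \<iota>(1)] G.Mor_zero[OF obj(1,2) \<iota>(1)]
  note Gm\<eta> = G.Mor_add[OF obj(1,3) \<eta>] G.Mor_smult[OF obj(1,3) \<eta>] G.Mor_closed[OF obj(1,3) \<eta>]
    G.Mor_mult[OF obj(1,3) \<eta>] G.Mor_zero[OF obj(1,3) \<eta>]
  have \<iota>c: "\<iota> r \<in> carrier K" and \<eta>c: "\<eta> r \<in> carrier R" if "r \<in> carrier B" for r
    using \<iota>(1) \<eta> that by (auto simp: rng_hom_def ring_hom_def)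
  have "\<forall>i\<in>I. \<exists>w. w \<in> carrier (Ob G B) \<and> h (Mor F B K \<iota> (e i)) = Mor G B K \<iota> w"
    using im by blast
  then obtain w where w: "\<And>i. i \<in> I \<Longrightarrow> w i \<in> carrier (Ob G B)"
      "\<And>i. i \<in> I \<Longrightarrow> h (Mor F B K \<iota> (e i)) = Mor G B K \<iota> (w i)"
    by metis
  obtain h' where h': "h' \<in> module_hom R (Ob F R) (Ob G R)"
    and h'e: "\<And>i. i \<in> I \<Longrightarrow> h' (Mor F B R \<eta> (e i)) = Mor G B R \<eta> (w i)"
    using pR.linear_extension[OF G.module[OF obj(3)], of "\<lambda>i. Mor G B R \<eta> (w i)"] Gm\<eta>(3) w(1) by blast
  note hs = module_hom_add[OF h(1)] module_hom_smult[OF h(1)]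
    module_hom_zero[OF F.module[OF obj(2)] G.module[OF obj(2)] h(1)]
  note h's = module_hom_add[OF h'] module_hom_smult[OF h']
    module_hom_zero[OF F.module[OF obj(3)] G.module[OF obj(3)] h']
  have rel: "\<exists>w\<in>carrier (Ob G B). h (Mor F B K \<iota> z) = Mor G B K \<iota> w \<and> h' (Mor F B R \<eta> z) = Mor G B R \<eta> w"
    if z: "z \<in> carrier (Ob F B)" for z
    using z
  proof (induction rule: p.coord_induct)
    case zero
    then show ?case
      using abelian_groupE(2)[OF G.abelian[OF obj(1)]]
      by (intro bexI[of _ "\<zero>\<^bsub>Ob G B\<^esub>"]) (simp_all add: Fm\<iota> Fm\<eta> Gm\<iota> Gm\<eta> hs h's)
  next
    case (e i)
    then show ?case using w h'e by blast
  next
    case (add x y)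
    then obtain u v where "u \<in> carrier (Ob G B)" "h (Mor F B K \<iota> x) = Mor G B K \<iota> u" "h' (Mor F B R \<eta> x) = Mor G B R \<eta> u"
      "v \<in> carrier (Ob G B)" "h (Mor F B K \<iota> y) = Mor G B K \<iota> v" "h' (Mor F B R \<eta> y) = Mor G B R \<eta> v"
      by blast
    then show ?case
      using add.hyps
      by (intro bexI[of _ "u \<oplus>\<^bsub>Ob G B\<^esub> v"])
        (simp_all add: Fm\<iota> Fm\<eta> Gm\<iota> Gm\<eta> hs h's G.add_closed[OF obj(1)])
  next
    case (smult r x)
    then obtain u where "u \<in> carrier (Ob G B)" "h (Mor F B K \<iota> x) = Mor G B K \<iota> u" "h' (Mor F B R \<eta> x) = Mor G B R \<eta> u"
      by blast
    then show ?case
      using smult.hyps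
      by (intro bexI[of _ "r \<odot>\<^bsub>Ob G B\<^esub> u"])
        (simp_all add: Fm\<iota> Fm\<eta> Gm\<iota> Gm\<eta> hs h's \<iota>c \<eta>c G.smult_closed[OF obj(1)])
  qed
  have Ginj: "inj_on (Mor G B K \<iota>) (carrier (Ob G B))"
    by (rule G.Mor_inj[OF obj(1,2) \<iota>(1) q qK \<iota>(2)])
  have "h' \<in> hom (Ob F R) (Ob G R)"
  proof (rule multiplicative_on_basis[OF F.algebra[OF obj(3)] G.algebra[OF obj(3)] h' pR])
    fix i j assume ij: "i \<in> I" "j \<in> I"
    note ec = p.e_closed[OF ij(1)] p.e_closed[OF ij(2)]
    have eij: "e i \<otimes>\<^bsub>Ob F B\<^esub> e j \<in> carrier (Ob F B)"
      using nonassoc_algebra.mult_closed[OF F.algebra[OF obj(1)]] ec by blast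
    have wij: "w i \<otimes>\<^bsub>Ob G B\<^esub> w j \<in> carrier (Ob G B)"
      using nonassoc_algebra.mult_closed[OF G.algebra[OF obj(1)]] w(1) ij by blast
    obtain u where u: "u \<in> carrier (Ob G B)"
      "h (Mor F B K \<iota> (e i \<otimes>\<^bsub>Ob F B\<^esub> e j)) = Mor G B K \<iota> u"
      "h' (Mor F B R \<eta> (e i \<otimes>\<^bsub>Ob F B\<^esub> e j)) = Mor G B R \<eta> u"
      using rel[OF eij] by blast
    have "Mor G B K \<iota> u = h (Mor F B K \<iota> (e i) \<otimes>\<^bsub>Ob F K\<^esub> Mor F B K \<iota> (e j))"
      using u(2) ec by (simp add: Fm\<iota>)
    also have "\<dots> = h (Mor F B K \<iota> (e i)) \<otimes>\<^bsub>Ob G K\<^esub> h (Mor F B K \<iota> (e j))"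
      by (rule hom_mult[OF h(2)]) (simp_all add: Fm\<iota> ec)
    also have "\<dots> = Mor G B K \<iota> (w i \<otimes>\<^bsub>Ob G B\<^esub> w j)"
      using w ij by (simp add: Gm\<iota>)
    finally have "u = w i \<otimes>\<^bsub>Ob G B\<^esub> w j"
      using inj_onD[OF Ginj _ u(1) wij] by blast
    then have "h' (Mor F B R \<eta> (e i) \<otimes>\<^bsub>Ob F R\<^esub> Mor F B R \<eta> (e j)) = Mor G B R \<eta> (w i \<otimes>\<^bsub>Ob G B\<^esub> w j)"
      using u(3) ec by (simp add: Fm\<eta>)
    also have "\<dots> = h' (Mor F B R \<eta> (e i)) \<otimes>\<^bsub>Ob G R\<^esub> h' (Mor F B R \<eta> (e j))"
      using w ij by (simp add: Gm\<eta> h'e)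
    finally show "h' (Mor F B R \<eta> (e i) \<otimes>\<^bsub>Ob F R\<^esub> Mor F B R \<eta> (e j))
      = h' (Mor F B R \<eta> (e i)) \<otimes>\<^bsub>Ob G R\<^esub> h' (Mor F B R \<eta> (e j))" .
  qed
  with h' rel that show thesis by blast
qed

text \<open>
  The maps \<open>h\<close> and \<open>g\<close> restrict to \<open>F(B)\<close> and \<open>G(B)\<close>, and \<open>h'\<close> and \<open>g'\<close> are the base changes of these
  restrictions. As \<open>F(B)\<close> embeds into \<open>F(K)\<close>, the restrictions compose to the identity, which is
  then inherited by the images of the basis in \<open>F(R)\<close>.
\<close>

lemma specialised_inverse:
  assumes F: "invariant_functor Z F"
    and obj: "B \<in> rng_obj" "K \<in> rng_obj" "R \<in> rng_obj"
    and \<iota>: "\<iota> \<in> rng_hom B K" "inj_on \<iota> (carrier B)" and \<eta>: "\<eta> \<in> rng_hom B R"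
    and p: "coordinate_system B (Ob F B) I e p"
    and pK: "coordinate_system K (Ob F K) I (\<lambda>i. Mor F B K \<iota> (e i)) pK"
    and pR: "coordinate_system R (Ob F R) I (\<lambda>i. Mor F B R \<eta> (e i)) pR"
    and inv: "\<And>x. x \<in> carrier (Ob F K) \<Longrightarrow> g (h x) = x"
    and h': "h' \<in> module_hom R (Ob F R) (Ob G R)"
    and rel_h: "\<And>z. z \<in> carrier (Ob F B) \<Longrightarrow>
      \<exists>w\<in>carrier (Ob G B). h (Mor F B K \<iota> z) = Mor G B K \<iota> w \<and> h' (Mor F B R \<eta> z) = Mor G B R \<eta> w"
    and g': "g' \<in> module_hom R (Ob G R) (Ob F R)"
    and rel_g: "\<And>w. w \<in> carrier (Ob G B) \<Longrightarrow>
      \<exists>z\<in>carrier (Ob F B). g (Mor G B K \<iota> w) = Mor F B K \<iota> z \<and> g' (Mor G B R \<eta> w) = Mor F B R \<eta> z"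
    and x: "x \<in> carrier (Ob F R)"
  shows "g' (h' x) = x"
proof -
  interpret F: invariant_functor Z F by fact
  interpret p: coordinate_system B "Ob F B" I e p by fact
  interpret pR: coordinate_system R "Ob F R" I "\<lambda>i. Mor F B R \<eta> (e i)" pR by fact
  have h'c: "h' y \<in> carrier (Ob G R)" if "y \<in> carrier (Ob F R)" for y
    using module_hom_closed[OF h'] that by auto
  have "(\<lambda>x. g' (h' x)) \<in> module_hom R (Ob F R) (Ob F R)"
    using module_hom_closed[OF g'] h'c
    by (auto simp: module_hom_def module_hom_add[OF h'] module_hom_add[OF g']
        module_hom_smult[OF h'] module_hom_smult[OF g'])
  moreover have "(\<lambda>x. x) \<in> module_hom R (Ob F R) (Ob F R)"
    by (simp add: module_hom_def)
  moreover have "g' (h' (Mor F B R \<eta> (e i))) = Mor F B R \<eta> (e i)" if i: "i \<in> I" for i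
  proof -
    note ei = p.e_closed[OF i]
    obtain w where w: "w \<in> carrier (Ob G B)" "h (Mor F B K \<iota> (e i)) = Mor G B K \<iota> w"
      "h' (Mor F B R \<eta> (e i)) = Mor G B R \<eta> w"
      using rel_h[OF ei] by blast
    obtain z where z: "z \<in> carrier (Ob F B)" "g (Mor G B K \<iota> w) = Mor F B K \<iota> z"
      "g' (Mor G B R \<eta> w) = Mor F B R \<eta> z"
      using rel_g[OF w(1)] by blast
    have "Mor F B K \<iota> z = Mor F B K \<iota> (e i)"
      using inv[OF F.Mor_closed[OF obj(1,2) \<iota>(1) ei]] w(2) z(2) by simp
    then have "z = e i"
      using inj_onD[OF F.Mor_inj[OF obj(1,2) \<iota>(1) p pK \<iota>(2)]] z(1) ei by blast
    with w z show ?thesis by simp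
  qed
  ultimately show ?thesis
    using pR.module_hom_eq[OF _ _ F.module[OF obj(3)] _ x] by blast
qed

text \<open>
  The entries of both matrices, of \<open>h\<close> and of its inverse, have to lie in \<open>B\<close>; then both maps
  specialise, and they remain inverse to each other.
\<close>

lemma alg_iso_specialises:
  assumes F: "invariant_functor Z F" and G: "invariant_functor Z G"
    and obj: "B \<in> rng_obj" "K \<in> rng_obj" "R \<in> rng_obj"
    and \<iota>: "\<iota> \<in> rng_hom B K" "inj_on \<iota> (carrier B)" and \<eta>: "\<eta> \<in> rng_hom B R"
    and p: "coordinate_system B (Ob F B) I e p"
    and pK: "coordinate_system K (Ob F K) I (\<lambda>i. Mor F B K \<iota> (e i)) pK"
    and q: "coordinate_system B (Ob G B) J d q"
    and qK: "coordinate_system K (Ob G K) J (\<lambda>j. Mor G B K \<iota> (d j)) qK"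
    and h: "h \<in> alg_iso K (Ob F K) (Ob G K)"
    and im: "\<And>i j. \<lbrakk>i \<in> I; j \<in> J\<rbrakk> \<Longrightarrow> qK j (h (Mor F B K \<iota> (e i))) \<in> \<iota> ` carrier B"
    and im': "\<And>i j. \<lbrakk>i \<in> I; j \<in> J\<rbrakk>
      \<Longrightarrow> pK i (inv_into (carrier (Ob F K)) h (Mor G B K \<iota> (d j))) \<in> \<iota> ` carrier B"
  shows "alg_isomorphic R (Ob F R) (Ob G R)"
proof -
  interpret F: invariant_functor Z F by fact
  interpret G: invariant_functor Z G by fact
  interpret pK: coordinate_system K "Ob F K" I "\<lambda>i. Mor F B K \<iota> (e i)" pK by fact
  interpret qK: coordinate_system K "Ob G K" J "\<lambda>j. Mor G B K \<iota> (d j)" qK by fact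
  obtain pR where pR: "coordinate_system R (Ob F R) I (\<lambda>i. Mor F B R \<eta> (e i)) pR"
    using F.coordinates_base_change[OF obj(1,3) \<eta> p] by blast
  obtain qR where qR: "coordinate_system R (Ob G R) J (\<lambda>j. Mor G B R \<eta> (d j)) qR"
    using G.coordinates_base_change[OF obj(1,3) \<eta> q] by blast
  define g where "g = inv_into (carrier (Ob F K)) h"
  have g: "g \<in> alg_iso K (Ob G K) (Ob F K)"
    unfolding g_def by (rule alg_iso_inverse[OF F.algebra[OF obj(2)] h])
  have h_hom: "h \<in> module_hom K (Ob F K) (Ob G K)" "h \<in> hom (Ob F K) (Ob G K)"
    and h_bij: "bij_betw h (carrier (Ob F K)) (carrier (Ob G K))"
    using h by (simp_all add: alg_iso_def)
  have g_hom: "g \<in> module_hom K (Ob G K) (Ob F K)" "g \<in> hom (Ob G K) (Ob F K)"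
    using g by (simp_all add: alg_iso_def)
  have hc: "h x \<in> carrier (Ob G K)" if "x \<in> carrier (Ob F K)" for x
    using module_hom_closed[OF h_hom(1)] that by auto
  have gc: "g x \<in> carrier (Ob F K)" if "x \<in> carrier (Ob G K)" for x
    using module_hom_closed[OF g_hom(1)] that by auto
  have gh: "g (h x) = x" if "x \<in> carrier (Ob F K)" for x
    using bij_betw_inv_into_left[OF h_bij that] by (simp add: g_def)
  have hg: "h (g y) = y" if "y \<in> carrier (Ob G K)" for y
    using bij_betw_inv_into_right[OF h_bij that] by (simp add: g_def)
  have "h (Mor F B K \<iota> (e i)) \<in> Mor G B K \<iota> ` carrier (Ob G B)" if i: "i \<in> I" for i
    by (rule G.Mor_image[OF obj(1,2) \<iota>(1) q qK hc[OF pK.e_closed[OF i]] im[OF i]])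
  then obtain h' where h': "h' \<in> module_hom R (Ob F R) (Ob G R)" "h' \<in> hom (Ob F R) (Ob G R)"
    and rel_h: "\<And>z. z \<in> carrier (Ob F B) \<Longrightarrow>
      \<exists>w\<in>carrier (Ob G B). h (Mor F B K \<iota> z) = Mor G B K \<iota> w \<and> h' (Mor F B R \<eta> z) = Mor G B R \<eta> w"
    using hom_specialises[OF F G obj \<iota> \<eta> p pR q qK h_hom] by blast
  have "g (Mor G B K \<iota> (d j)) \<in> Mor F B K \<iota> ` carrier (Ob F B)" if j: "j \<in> J" for j
    by (rule F.Mor_image[OF obj(1,2) \<iota>(1) p pK gc[OF qK.e_closed[OF j]] im'[OF _ j, folded g_def]])
  then obtain g' where g': "g' \<in> module_hom R (Ob G R) (Ob F R)"
    and rel_g: "\<And>z. z \<in> carrier (Ob G B) \<Longrightarrow>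
      \<exists>w\<in>carrier (Ob F B). g (Mor G B K \<iota> z) = Mor F B K \<iota> w \<and> g' (Mor G B R \<eta> z) = Mor F B R \<eta> w"
    using hom_specialises[OF G F obj \<iota> \<eta> q qR p pK g_hom] by blast
  have "bij_betw h' (carrier (Ob F R)) (carrier (Ob G R))"
  proof (rule bij_betw_byWitness[where f' = g'])
    show "\<forall>x\<in>carrier (Ob F R). g' (h' x) = x"
      using specialised_inverse[OF F obj \<iota> \<eta> p pK pR gh h'(1) rel_h g' rel_g] by blast
    show "\<forall>y\<in>carrier (Ob G R). h' (g' y) = y"
      using specialised_inverse[OF G obj \<iota> \<eta> q qK qR hg g' rel_g h'(1) rel_h] by blast
    show "h' ` carrier (Ob F R) \<subseteq> carrier (Ob G R)" "g' ` carrier (Ob G R) \<subseteq> carrier (Ob F R)"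
      using module_hom_closed[OF h'(1)] module_hom_closed[OF g'] by auto
  qed
  with h' show ?thesis by (auto simp: alg_isomorphic_def alg_iso_def)
qed

theorem theorem4p9:
  fixes Z K R :: "'u ring"
    and F :: "('u, 'b) functor_data"
    and G :: "('u, 'c) functor_data"
    and Qbar :: "'q ring"
    and i :: "'u \<Rightarrow> 'q" and j :: "'q \<Rightarrow> 'u"
  assumes "integers_object Z"
    and "extension_invariant Z F"
    and "extension_invariant Z G"
    and "field K"
    and "vectorspace.fin_dim K (Ob F K)"
    and "vectorspace.fin_dim K (Ob G K)"
    and "alg_isomorphic K (Ob F K) (Ob G K)"
    and "is_algebraic_closure Qbar (K\<lparr>carrier := prime_field K\<rparr>) i"
    and "cring R"
    and "j \<in> ring_hom Qbar R" and "inj_on j (carrier Qbar)"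
  shows "alg_isomorphic R (Ob F R) (Ob G R)"
proof -
  let ?Q = "K\<lparr>carrier := prime_field K\<rparr>"
  have "Z \<in> rng_obj" using assms(1) by (simp add: integers_object_def)
  then have F: "invariant_functor Z F" and G: "invariant_functor Z G"
    using assms(2,3) by (simp_all add: invariant_functor_def invariant_functor_axioms_def)
  interpret F: invariant_functor Z F by fact
  interpret G: invariant_functor Z G by fact
  interpret K: field K by fact
  interpret R: cring R by fact
  have closure: "algebraic_closure Qbar (i ` prime_field K)" and i: "i \<in> ring_hom ?Q Qbar"
    using assms(8) by (simp_all add: is_algebraic_closure_def)
  interpret C: algebraic_closure Qbar "i ` prime_field K" by (rule closure)
  have C: "algebraically_closed Qbar" by (rule C.algebraically_closed_axioms)
  note Q = prime_field_subfield[OF assms(4)]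
  interpret Q: field ?Q using K.subfield_iff(2)[OF Q] .
  have Qo: "?Q \<in> rng_obj" using Q.is_cring Q.one_not_zero by (simp add: rng_obj_def)
  have Ko: "K \<in> rng_obj" using K.is_cring K.one_not_zero by (simp add: rng_obj_def)
  have j0: "j \<zero>\<^bsub>Qbar\<^esub> = \<zero>\<^bsub>R\<^esub>"
    by (rule ring_hom_zero[OF assms(10) C.ring_axioms R.ring_axioms])
  have "\<one>\<^bsub>R\<^esub> \<noteq> \<zero>\<^bsub>R\<^esub>"
    using inj_onD[OF assms(11), of "\<one>\<^bsub>Qbar\<^esub>" "\<zero>\<^bsub>Qbar\<^esub>"] ring_hom_one[OF assms(10)] j0 by auto
  then have Ro: "R \<in> rng_obj" using assms(9) by (simp add: rng_obj_def)
  obtain I :: "'b set" and eQ pQ where pQ: "coordinate_system ?Q (Ob F ?Q) I eQ pQ"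
    using F.coordinates_over_subfield[OF assms(4) Q assms(5)] by blast
  obtain J :: "'c set" and dQ qQ where qQ: "coordinate_system ?Q (Ob G ?Q) J dQ qQ"
    using G.coordinates_over_subfield[OF assms(4) Q assms(6)] by blast
  interpret pQ: coordinate_system ?Q "Ob F ?Q" I eQ pQ by fact
  interpret qQ: coordinate_system ?Q "Ob G ?Q" J dQ qQ by fact
  define \<alpha> where "\<alpha> = (\<lambda>r\<in>prime_field K. r)"
  have \<alpha>: "\<alpha> \<in> rng_hom ?Q K"
    unfolding \<alpha>_def by (rule subring_inclusion_rng_hom[OF subfieldE(1)[OF Q]])
  obtain pK where pK: "coordinate_system K (Ob F K) I (\<lambda>i. Mor F ?Q K \<alpha> (eQ i)) pK"
    using F.coordinates_base_change[OF Qo Ko \<alpha> pQ] by blast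
  obtain qK where qK: "coordinate_system K (Ob G K) J (\<lambda>j. Mor G ?Q K \<alpha> (dQ j)) qK"
    using G.coordinates_base_change[OF Qo Ko \<alpha> qQ] by blast
  interpret pK: coordinate_system K "Ob F K" I "\<lambda>i. Mor F ?Q K \<alpha> (eQ i)" pK by fact
  interpret qK: coordinate_system K "Ob G K" J "\<lambda>j. Mor G ?Q K \<alpha> (dQ j)" qK by fact
  obtain h where h: "h \<in> alg_iso K (Ob F K) (Ob G K)"
    using assms(7) by (auto simp: alg_isomorphic_def)
  define g where "g = inv_into (carrier (Ob F K)) h"
  have g: "g \<in> alg_iso K (Ob G K) (Ob F K)"
    unfolding g_def by (rule alg_iso_inverse[OF F.algebra[OF Ko] h])
  \<comment> \<open>The matrix entries of the isomorphism and of its inverse.\<close>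
  define E where "E = (\<lambda>(i, j). qK j (h (Mor F ?Q K \<alpha> (eQ i)))) ` (I \<times> J)
    \<union> (\<lambda>(i, j). pK i (g (Mor G ?Q K \<alpha> (dQ j)))) ` (I \<times> J)"
  have hc: "h x \<in> carrier (Ob G K)" if "x \<in> carrier (Ob F K)" for x
    using h that by (auto simp: alg_iso_def hom_def)
  have gc: "g x \<in> carrier (Ob F K)" if "x \<in> carrier (Ob G K)" for x
    using g that by (auto simp: alg_iso_def hom_def)
  have "finite E"
    unfolding E_def using pQ.finite_index qQ.finite_index by simp
  moreover have "E \<subseteq> carrier K"
    unfolding E_def
    by (auto intro!: qK.coord_closed pK.coord_closed hc gc pK.e_closed qK.e_closed)
  ultimately obtain A \<psi> where A: "subring A K" "prime_field K \<subseteq> A" "E \<subseteq> A"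
    and \<psi>: "\<psi> \<in> ring_hom (K\<lparr>carrier := A\<rparr>) Qbar"
    using partial_hom_to_algebraically_closed[OF K.domain_axioms Q C i] by metis
  let ?B = "K\<lparr>carrier := A\<rparr>"
  interpret B: domain ?B using K.subring_is_domain[OF A(1)] .
  have Bo: "?B \<in> rng_obj" using B.is_cring B.one_not_zero by (simp add: rng_obj_def)
  define \<iota> where "\<iota> = (\<lambda>r\<in>A. r)"
  have \<iota>: "\<iota> \<in> rng_hom ?B K" "inj_on \<iota> (carrier ?B)" "\<iota> ` carrier ?B = A"
    unfolding \<iota>_def using subring_inclusion_rng_hom[OF A(1)] by (auto simp: inj_on_def)
  define \<eta> where "\<eta> = (\<lambda>a\<in>A. j (\<psi> a))"
  have \<eta>: "\<eta> \<in> rng_hom ?B R"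
  proof -
    have "\<eta> \<in> ring_hom ?B R"
      using subringE[OF A(1)] ring_hom_closed[OF \<psi>] ring_hom_closed[OF assms(10)]
        ring_hom_mult[OF \<psi>] ring_hom_mult[OF assms(10)] ring_hom_add[OF \<psi>] ring_hom_add[OF assms(10)]
        ring_hom_one[OF \<psi>] ring_hom_one[OF assms(10)]
      by (intro ring_hom_memI) (simp_all add: \<eta>_def)
    then show ?thesis by (simp add: rng_hom_def \<eta>_def)
  qed
  define \<beta> where "\<beta> = (\<lambda>r\<in>prime_field K. r)"
  have \<beta>: "\<beta> \<in> rng_hom ?Q ?B"
  proof -
    have "\<beta> \<in> ring_hom ?Q ?B"
      using subringE[OF subfieldE(1)[OF Q]] A(2) by (intro ring_hom_memI) (auto simp: \<beta>_def)
    then show ?thesis by (simp add: rng_hom_def \<beta>_def)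
  qed
  \<comment> \<open>The basis of \<open>F(K)\<close> that comes from \<open>F(Q)\<close> is also the one that comes from \<open>F(A)\<close>.\<close>
  have comp: "compose (carrier ?Q) \<iota> \<beta> = \<alpha>"
    using A(2) by (auto simp: compose_def \<iota>_def \<beta>_def \<alpha>_def fun_eq_iff)
  obtain p where p: "coordinate_system ?B (Ob F ?B) I (\<lambda>i. Mor F ?Q ?B \<beta> (eQ i)) p"
    using F.coordinates_base_change[OF Qo Bo \<beta> pQ] by blast
  obtain q where q: "coordinate_system ?B (Ob G ?B) J (\<lambda>j. Mor G ?Q ?B \<beta> (dQ j)) q"
    using G.coordinates_base_change[OF Qo Bo \<beta> qQ] by blast
  have eK: "Mor F ?B K \<iota> (Mor F ?Q ?B \<beta> (eQ i)) = Mor F ?Q K \<alpha> (eQ i)" if "i \<in> I" for i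
    using F.Mor_comp[OF Qo Bo Ko \<beta> \<iota>(1) pQ.e_closed[OF that]] comp by simp
  have dK: "Mor G ?B K \<iota> (Mor G ?Q ?B \<beta> (dQ j)) = Mor G ?Q K \<alpha> (dQ j)" if "j \<in> J" for j
    using G.Mor_comp[OF Qo Bo Ko \<beta> \<iota>(1) qQ.e_closed[OF that]] comp by simp
  show ?thesis
  proof (rule alg_iso_specialises[OF F G Bo Ko Ro \<iota>(1,2) \<eta> p _ q _ h])
    show "coordinate_system K (Ob F K) I (\<lambda>i. Mor F ?B K \<iota> (Mor F ?Q ?B \<beta> (eQ i))) pK"
      by (rule coordinate_system_cong[OF pK eK])
    show "coordinate_system K (Ob G K) J (\<lambda>j. Mor G ?B K \<iota> (Mor G ?Q ?B \<beta> (dQ j))) qK"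
      by (rule coordinate_system_cong[OF qK dK])
  next
    fix i j assume ij: "i \<in> I" "j \<in> J"
    then have "qK j (h (Mor F ?Q K \<alpha> (eQ i))) \<in> E" "pK i (g (Mor G ?Q K \<alpha> (dQ j))) \<in> E"
      unfolding E_def by force+
    with A(3) ij show "qK j (h (Mor F ?B K \<iota> (Mor F ?Q ?B \<beta> (eQ i)))) \<in> \<iota> ` carrier ?B"
      "pK i (inv_into (carrier (Ob F K)) h (Mor G ?B K \<iota> (Mor G ?Q ?B \<beta> (dQ j)))) \<in> \<iota> ` carrier ?B"
      unfolding \<iota>(3) g_def[symmetric] by (auto simp: eK dK)
  qed
qed

end
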